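(* Let $G$ be a graph with $n$ vertices and $m$ edges, with largest eigenvalue $\rho$ and nullity $\eta(G)=\kappa$. Let $G_1$ be any connected component of $G$ with spectral radius $\rho$, with $n_1$ vertices and $m_1$ edges, such that $\frac{2m_1}{n_1}\geq 1$. For $k\geq 0$ let $$\gamma_1^{(k)}=\sqrt{\frac{\sum_{i\in V(G_1)}d_{k+1}^{2}(i)}{\sum_{i\in V(G_1)}d_{k}^{2}(i)}},$$ where $d_k(i)$ is the $k$-degree of the vertex $i$ in $G_1$, and for $x>0$ let $$h(x)=x+n-\kappa-1+\ln\bigl|\Upsilon_{n-\kappa}(G)\bigr|-\ln x .$$ Then $\{h(\gamma_1^{(k)})\}_{k=0}^{\infty}$ is an increasing (i.e. non-decreasing) sequence converging to $h(\rho)$ and, for all $k\geq 0$, $$\mathcal{E}(G)\ \geq\ \gamma_1^{(k)}+n-\kappa-1+\ln\bigl|\Upsilon_{n-\kappa}(G)\bigr|-\ln\gamma_1^{(k)}.\qquad ( * )$$ In particular, if $G_1$ is $r_1$-regular, then $$\mathcal{E}(G)\ \geq\ r_1+n-\kappa-1+\ln\bigl|\Upsilon_{n-\kappa}(G)\bigr|-\ln r_1 .$$ If $\rho=1$, then equality holds in $( * )$ if and only if $G=\lfloor\frac{n-\kappa}{2}\rfloor K_2\cup\kappa K_1$. On the contrary, if $\rho>1$, then equality holds in $( * )$ if and only if $G=K_{n-\ell}\cup\kappa K_1\cup\lfloor\frac{\ell-\kappa}{2}\rfloor K_2$ for some $\ell$ with $\kappa\leq\ell\leq n-3$.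
   Context: Graphs are finite, undirected and simple. The eigenvalues of $G$ are those of its adjacency matrix $A(G)$. The energy $\mathcal{E}(G)$ is the sum of the absolute values of the eigenvalues of $G$, counted with multiplicity. The nullity $\eta(G)$ is the multiplicity of $0$ as an eigenvalue of $A(G)$. For a square matrix $M$ of order $n$ with eigenvalues $\mu_1,\dots,\mu_n$, $\Upsilon_k(M)=\sum_{1\le i_1<\cdots<i_k\le n}\mu_{i_1}\cdots\mu_{i_k}$, and $\Upsilon_{n-\kappa}(G)=\Upsilon_{n-\kappa}(A(G))$. The $k$-degree $d_k(i)$ of a vertex $i$ is the number of walks of length $k$ starting at $i$: $d_0(i)=1$, $d_1(i)$ is the degree of $i$, and $d_{k+1}(i)=\sum_{j\in N(i)}d_k(j)$, where $N(i)$ is the set of neighbours of $i$. A graph is $r$-regular if every vertex has degree $r$. $K_s$ is the complete graph on $s$ vertices, $tH$ denotes the disjoint union of $t$ copies of $H$ (empty if $t=0$), $\cup$ denotes disjoint union, and equality of graphs means isomorphism. *)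

theory Defs
  imports "Jordan_Normal_Form.Spectral_Radius" "HOL-Library.Countable_Set"
begin

type_synonym 'a ugraph = "'a set \<times> 'a set set"

abbreviation verts :: "'a ugraph \<Rightarrow> 'a set" where "verts \<equiv> fst"
abbreviation edges :: "'a ugraph \<Rightarrow> 'a set set" where "edges \<equiv> snd"

definition simple_graph :: "'a ugraph \<Rightarrow> bool" where
  "simple_graph G \<longleftrightarrow> finite (verts G) \<and> (\<forall>e\<in>edges G. e \<subseteq> verts G \<and> card e = 2)"

definition adjacent :: "'a ugraph \<Rightarrow> 'a \<Rightarrow> 'a \<Rightarrow> bool" where
  "adjacent G u v \<longleftrightarrow> {u, v} \<in> edges G"

definition neighbours :: "'a ugraph \<Rightarrow> 'a \<Rightarrow> 'a set" where
  "neighbours G v = {u \<in> verts G. adjacent G v u}"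

definition regular_graph :: "nat \<Rightarrow> 'a ugraph \<Rightarrow> bool" where
  "regular_graph r G \<longleftrightarrow> (\<forall>v\<in>verts G. card (neighbours G v) = r)"

definition connected_component_of :: "'a ugraph \<Rightarrow> 'a ugraph \<Rightarrow> bool" where
  "connected_component_of H G \<longleftrightarrow>
     (\<exists>v\<in>verts G. verts H = {u \<in> verts G. (adjacent G)\<^sup>*\<^sup>* v u}) \<and>
     edges H = {e \<in> edges G. e \<subseteq> verts H}"

definition complete_graph :: "nat \<Rightarrow> nat ugraph" where
  "complete_graph s = ({..<s}, {e. e \<subseteq> {..<s} \<and> card e = 2})"

definition disjoint_union :: "'a ugraph \<Rightarrow> 'b ugraph \<Rightarrow> ('a + 'b) ugraph" where
  "disjoint_union G H =
     (verts G <+> verts H, (\<lambda>e. Inl ` e) ` edges G \<union> (\<lambda>e. Inr ` e) ` edges H)"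

definition copies :: "nat \<Rightarrow> 'a ugraph \<Rightarrow> (nat \<times> 'a) ugraph" where
  "copies t H = ({..<t} \<times> verts H, (\<Union>i<t. (\<lambda>e. Pair i ` e) ` edges H))"

definition graph_iso :: "'a ugraph \<Rightarrow> 'b ugraph \<Rightarrow> bool" where
  "graph_iso G H \<longleftrightarrow> (\<exists>f. bij_betw f (verts G) (verts H) \<and>
     (\<forall>u\<in>verts G. \<forall>v\<in>verts G. adjacent G u v \<longleftrightarrow> adjacent H (f u) (f v)))"

primrec kdegree :: "'a ugraph \<Rightarrow> nat \<Rightarrow> 'a \<Rightarrow> nat" where
  "kdegree G 0 i = 1"
| "kdegree G (Suc k) i = (\<Sum>j\<in>neighbours G i. kdegree G k j)"

definition kdegree_ratio :: "'a ugraph \<Rightarrow> nat \<Rightarrow> real" where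
  "kdegree_ratio G k =
     sqrt (real (\<Sum>i\<in>verts G. (kdegree G (k + 1) i)\<^sup>2) / real (\<Sum>i\<in>verts G. (kdegree G k i)\<^sup>2))"

text \<open>The eigenvalues of a square complex matrix, listed with algebraic multiplicity in an
  unspecified order.\<close>

definition eigenvalue_list :: "complex mat \<Rightarrow> complex list" where
  "eigenvalue_list M = (SOME \<mu>s. char_poly M = (\<Prod>\<mu>\<leftarrow>\<mu>s. [:- \<mu>, 1:]) \<and> length \<mu>s = dim_row M)"

lemma eigenvalue_list:
  assumes "M \<in> carrier_mat n n"
  shows "char_poly M = (\<Prod>\<mu>\<leftarrow>eigenvalue_list M. [:- \<mu>, 1:])" "length (eigenvalue_list M) = n"
proof -
  have "\<exists>\<mu>s. char_poly M = (\<Prod>\<mu>\<leftarrow>\<mu>s. [:- \<mu>, 1:]) \<and> length \<mu>s = dim_row M"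
    using char_poly_factorized[OF assms] assms by auto
  from someI_ex[OF this] assms
  show "char_poly M = (\<Prod>\<mu>\<leftarrow>eigenvalue_list M. [:- \<mu>, 1:])" "length (eigenvalue_list M) = n"
    unfolding eigenvalue_list_def by auto
qed

definition Upsilon :: "nat \<Rightarrow> complex mat \<Rightarrow> complex" where
  "Upsilon k M =
     (\<Sum>I\<in>{I. I \<subseteq> {..<dim_row M} \<and> card I = k}. \<Prod>i\<in>I. eigenvalue_list M ! i)"

text \<open>For finite V the function from_nat_into V restricts to a bijection from {..<card V} onto
  V; nothing below depends on which enumeration of the vertices is used.  The matrix is real
  symmetric, but is taken over the complex numbers so that it has all its eigenvalues there.
  These are real, so the real part in the largest eigenvalue loses nothing.\<close>

definition adj_matrix :: "'a ugraph \<Rightarrow> complex mat" where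
  "adj_matrix G = mat (card (verts G)) (card (verts G))
     (\<lambda>(i, j). if adjacent G (from_nat_into (verts G) i) (from_nat_into (verts G) j) then 1 else 0)"

definition largest_eigenvalue :: "'a ugraph \<Rightarrow> real" where
  "largest_eigenvalue G = Max (Re ` spectrum (adj_matrix G))"

definition energy :: "'a ugraph \<Rightarrow> real" where
  "energy G = (\<Sum>\<mu>\<leftarrow>eigenvalue_list (adj_matrix G). cmod \<mu>)"

definition nullity :: "'a ugraph \<Rightarrow> nat" where
  "nullity G = count_list (eigenvalue_list (adj_matrix G)) 0"

end

theory Submission
  imports Defs "HOL-Analysis.Convex"
begin

text \<open>
  Write \<open>\<lambda>\<^sub>1, \<dots>, \<lambda>\<^sub>n\<close> for the eigenvalues of \<open>G\<close>. Only the product of all nonzero eigenvalues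
  contributes to \<open>\<Upsilon>\<close>, so applying \<open>ln t \<le> t - 1\<close> to the modulus of every nonzero eigenvalue
  except one copy of \<open>\<rho>\<close> gives \<open>\<E>(G) \<ge> h(\<rho>)\<close>, with equality iff all of these moduli are 1. As
  \<open>t - ln t\<close> increases strictly on \<open>[1, \<infinity>)\<close>, the bounds at \<open>\<gamma>\<^sub>k\<close> follow from
  \<open>1 \<le> \<gamma>\<^sub>k \<le> \<gamma>\<^sub>k\<^sub>+\<^sub>1 \<le> \<rho>\<close>. Here \<open>\<gamma>\<^sub>k\<close> is a ratio of norms of consecutive iterates of the self-adjoint
  adjacency operator; such norms are log-convex, and they grow at rate exactly \<open>\<rho>\<close>.

  In the equality case with \<open>\<rho> > 1\<close> every eigenvalue is at least -1. Hence \<open>x \<bullet> A x \<ge> - x \<bullet> x\<close>, which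
  for \<open>x = (1, -1, 1)\<close> excludes an induced path on three vertices, so \<open>G\<close> is a disjoint union of
  complete graphs. The trace of \<open>A\<^sup>3 - A\<close> shows that only one of them has more than two vertices, and
  the trace of \<open>A\<^sup>2\<close> shows that the number of isolated vertices is the nullity. Conversely, for such
  a graph the trace of \<open>A\<^sup>2\<close> forces \<open>\<rho>\<close> to be a simple eigenvalue.
\<close>

section \<open>Log-convex sequences and self-adjoint kernels\<close>

text \<open>Positivity propagates: if \<open>q k\<close> and \<open>q (Suc k)\<close> are positive,
  then so is the product on the right of \<open>convex\<close>. Dividing \<open>convex\<close> by
  \<open>q k * q (Suc k)\<close> then compares consecutive ratios.\<close>

lemma log_convex_ratio:
  fixes q :: "nat \<Rightarrow> real"
  assumes nonneg: "\<And>k. 0 \<le> q k" and convex: "\<And>k. (q (Suc k))\<^sup>2 \<le> q k * q (Suc (Suc k))"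
    and pos: "0 < q 0" "0 < q 1"
  shows "0 < q k" and "incseq (\<lambda>k. q (Suc k) / q k)"
proof -
  have *: "0 < q k \<and> 0 < q (Suc k)" for k
  proof (induction k)
    case (Suc k)
    then have "0 < (q (Suc k))\<^sup>2" by simp
    then have "0 < q k * q (Suc (Suc k))" using convex[of k] by linarith
    then show ?case using Suc by (simp add: zero_less_mult_iff)
  qed (use pos in simp)
  then show "0 < q k" by blast
  show "incseq (\<lambda>k. q (Suc k) / q k)"
  proof (rule incseq_SucI)
    fix k
    show "q (Suc k) / q k \<le> q (Suc (Suc k)) / q (Suc k)"
      using *[of k] convex[of k] by (simp add: field_simps power2_eq_square)
  qed
qed

text \<open>The ratios never fall below the first one, so the sequence grows at least
  geometrically.\<close>

lemma log_convex_growth: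
  fixes q :: "nat \<Rightarrow> real"
  assumes "\<And>k. 0 \<le> q k" "\<And>k. (q (Suc k))\<^sup>2 \<le> q k * q (Suc (Suc k))"
    and "0 < q 0" "0 < q 1"
  shows "q 0 * (q 1 / q 0) ^ k \<le> q k"
proof (induction k)
  case (Suc k)
  have pos: "0 < q j" for j by (rule log_convex_ratio) fact+
  have inc: "incseq (\<lambda>k. q (Suc k) / q k)" by (rule log_convex_ratio) fact+
  from incseqD[OF inc, of 0 k] have r: "q 1 / q 0 \<le> q (Suc k) / q k" by simp
  have "q 0 * (q 1 / q 0) ^ Suc k = (q 0 * (q 1 / q 0) ^ k) * (q 1 / q 0)" by simp
  also have "\<dots> \<le> q k * (q (Suc k) / q k)"
    using Suc r pos[of 0] pos[of 1] pos[of k] by (intro mult_mono) (auto intro: less_imp_le)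
  also have "\<dots> = q (Suc k)" using pos[of k] by simp
  finally show ?case .
qed simp

text \<open>If the first step went up, the first ratio would exceed 1 and geometric growth would
  break any bound.\<close>

lemma log_convex_bounded:
  fixes q :: "nat \<Rightarrow> real"
  assumes nonneg: "\<And>k. 0 \<le> q k" and convex: "\<And>k. (q (Suc k))\<^sup>2 \<le> q k * q (Suc (Suc k))"
    and bounded: "\<And>k. q k \<le> C"
  shows "q 1 \<le> q 0"
proof (rule ccontr)
  assume "\<not> ?thesis"
  then have lt: "q 0 < q 1" by simp
  with nonneg[of 0] have q1: "0 < q 1" by linarith
  \<comment> \<open>With \<open>q 0 = 0\<close>, log-convexity at 0 would force the square of
    \<open>q 1\<close> to be at most 0.\<close>
  have "q 0 \<noteq> 0" using convex[of 0] q1 by auto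
  with nonneg[of 0] have q0: "0 < q 0" by simp
  obtain k where "C / q 0 < (q 1 / q 0) ^ k"
    using real_arch_pow[of "q 1 / q 0"] lt q0 by auto
  then have "C < q 0 * (q 1 / q 0) ^ k" using q0 by (simp add: field_simps)
  also have "\<dots> \<le> q k" by (rule log_convex_growth) fact+
  finally show False using bounded[of k] by simp
qed

text \<open>The enumeration is the one in \<open>adj_matrix\<close>, so results on functions over
  \<open>V\<close> transfer to that matrix. Arbitrary real kernels are allowed because the proofs
  below also scale, shift and negate the adjacency kernel.\<close>

definition kernel_mat :: "'a set \<Rightarrow> ('a \<Rightarrow> 'a \<Rightarrow> real) \<Rightarrow> complex mat" where
  "kernel_mat V a = mat (card V) (card V)
     (\<lambda>(i, j). complex_of_real (a (from_nat_into V i) (from_nat_into V j)))"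

definition kernel_op :: "'a set \<Rightarrow> ('a \<Rightarrow> 'a \<Rightarrow> real) \<Rightarrow> ('a \<Rightarrow> real) \<Rightarrow> 'a \<Rightarrow> real" where
  "kernel_op V a x v = (\<Sum>u\<in>V. a v u * x u)"

lemma kernel_mat_carrier [simp]: "kernel_mat V a \<in> carrier_mat (card V) (card V)"
  by (simp add: kernel_mat_def)

lemma kernel_mat_dim [simp]:
  "dim_row (kernel_mat V a) = card V" "dim_col (kernel_mat V a) = card V"
  by (simp_all add: kernel_mat_def)

lemma kernel_mat_mult_vec:
  fixes f :: "'a \<Rightarrow> complex"
  assumes "finite V"
  shows "kernel_mat V a *\<^sub>v vec (card V) (\<lambda>i. f (from_nat_into V i)) =
         vec (card V) (\<lambda>i. \<Sum>u\<in>V. of_real (a (from_nat_into V i) u) * f u)"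
  by (rule eq_vecI)
     (simp_all add: kernel_mat_def scalar_prod_def atLeast0LessThan
       sum.card_from_nat_into[where h = "\<lambda>u. of_real (a (from_nat_into V _) u) * f u"])

lemma from_nat_into_less_card:
  assumes "finite V" "i < card V"
  shows "from_nat_into V i \<in> V"
  using bij_betw_from_nat_into_finite[OF assms(1)] assms(2) by (auto simp: bij_betw_def)

lemma ex_from_nat_into_less_card:
  assumes "finite V" "v \<in> V"
  obtains i where "i < card V" "v = from_nat_into V i"
  using bij_betw_from_nat_into_finite[OF assms(1)] assms(2) by (auto simp: bij_betw_def)

text \<open>A dictionary between eigenvectors indexed by numbers and eigenfunctions on
  \<open>V\<close>; after it the enumeration can be forgotten in spectral arguments.\<close>

lemma eigenvalue_kernel_mat:
  assumes V: "finite V"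
  shows "eigenvalue (kernel_mat V a) z \<longleftrightarrow>
    (\<exists>f. (\<exists>v\<in>V. f v \<noteq> 0) \<and> (\<forall>v\<in>V. (\<Sum>u\<in>V. of_real (a v u) * f u) = z * f v))"
    (is "_ \<longleftrightarrow> (\<exists>f. ?P f)")
proof
  assume "eigenvalue (kernel_mat V a) z"
  then obtain x where x: "x \<in> carrier_vec (card V)" "x \<noteq> 0\<^sub>v (card V)"
      "kernel_mat V a *\<^sub>v x = z \<cdot>\<^sub>v x"
    unfolding eigenvalue_def eigenvector_def by (auto simp: kernel_mat_def)
  define f where "f v = x $ (the_inv_into {..<card V} (from_nat_into V) v)" for v
  have inj: "inj_on (from_nat_into V) {..<card V}"
    using bij_betw_from_nat_into_finite[OF V] by (simp add: bij_betw_def)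
  have fe: "f (from_nat_into V i) = x $ i" if "i < card V" for i
    using that inj by (simp add: f_def the_inv_into_f_f)
  have xf: "x = vec (card V) (\<lambda>i. f (from_nat_into V i))"
    using x(1) fe by (intro eq_vecI) auto
  have "?P f"
  proof
    obtain i where "i < card V" "x $ i \<noteq> 0" using x(1,2) by (metis carrier_vecD eq_vecI index_zero_vec)
    then show "\<exists>v\<in>V. f v \<noteq> 0" using from_nat_into_less_card[OF V] fe by metis
    show "\<forall>v\<in>V. (\<Sum>u\<in>V. of_real (a v u) * f u) = z * f v"
    proof
      fix v assume "v \<in> V"
      then obtain i where i: "i < card V" "v = from_nat_into V i"
        using ex_from_nat_into_less_card[OF V] by blast
      have "(kernel_mat V a *\<^sub>v x) $ i = (z \<cdot>\<^sub>v x) $ i" using x(3) by simp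
      then show "(\<Sum>u\<in>V. of_real (a v u) * f u) = z * f v"
        using i by (subst (asm) (1 2) xf) (simp add: kernel_mat_mult_vec[OF V])
    qed
  qed
  then show "\<exists>f. ?P f" by blast
next
  assume "\<exists>f. ?P f"
  then obtain f v where f: "v \<in> V" "f v \<noteq> 0"
    "\<And>v. v \<in> V \<Longrightarrow> (\<Sum>u\<in>V. of_real (a v u) * f u) = z * f v" by blast
  let ?x = "vec (card V) (\<lambda>i. f (from_nat_into V i))"
  obtain i where i: "i < card V" "v = from_nat_into V i"
    using ex_from_nat_into_less_card[OF V f(1)] by blast
  then have "?x $ i \<noteq> 0" using f by simp
  then have "?x \<noteq> 0\<^sub>v (card V)" using i(1) by (metis index_zero_vec(1))
  moreover have "kernel_mat V a *\<^sub>v ?x = z \<cdot>\<^sub>v ?x"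
    unfolding kernel_mat_mult_vec[OF V] by (rule eq_vecI) (auto simp: f(3) from_nat_into_less_card[OF V])
  ultimately show "eigenvalue (kernel_mat V a) z"
    unfolding eigenvalue_def eigenvector_def by (intro exI[of _ ?x]) (simp add: kernel_mat_def)
qed

text \<open>The Hermitian form \<open>S\<close> of an eigenfunction equals its own conjugate by
  symmetry, and it is \<open>z\<close> times a positive real by the eigenvalue equation.\<close>

lemma kernel_mat_eigenvalue_real:
  assumes V: "finite V" and sym: "\<And>u v. u \<in> V \<Longrightarrow> v \<in> V \<Longrightarrow> a u v = a v u"
    and "eigenvalue (kernel_mat V a) z"
  shows "z = of_real (Re z)"
proof -
  obtain f where f: "\<exists>v\<in>V. f v \<noteq> 0"
      "\<And>v. v \<in> V \<Longrightarrow> (\<Sum>u\<in>V. of_real (a v u) * f u) = z * f v"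
    using assms(3) unfolding eigenvalue_kernel_mat[OF V] by blast
  define S where "S = (\<Sum>v\<in>V. \<Sum>u\<in>V. of_real (a v u) * (f u * cnj (f v)))"
  have "cnj S = (\<Sum>v\<in>V. \<Sum>u\<in>V. of_real (a v u) * (f v * cnj (f u)))"
    by (simp add: S_def mult_ac)
  also have "\<dots> = (\<Sum>u\<in>V. \<Sum>v\<in>V. of_real (a v u) * (f v * cnj (f u)))"
    by (rule sum.swap)
  also have "\<dots> = S" unfolding S_def by (intro sum.cong refl) (simp add: sym)
  finally have realS: "cnj S = S" .
  have "S = (\<Sum>v\<in>V. cnj (f v) * (\<Sum>u\<in>V. of_real (a v u) * f u))"
    by (simp add: S_def sum_distrib_left mult_ac)
  also have "\<dots> = (\<Sum>v\<in>V. cnj (f v) * (z * f v))" by (intro sum.cong refl) (simp add: f(2))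
  also have "\<dots> = z * of_real (\<Sum>v\<in>V. (cmod (f v))\<^sup>2)"
    by (simp add: sum_distrib_left complex_norm_square mult_ac del: of_real_power)
  finally have S: "S = z * of_real (\<Sum>v\<in>V. (cmod (f v))\<^sup>2)" .
  have "(\<Sum>v\<in>V. (cmod (f v))\<^sup>2) > 0"
  proof -
    obtain v where "v \<in> V" "f v \<noteq> 0" using f(1) by blast
    then show ?thesis by (intro sum_pos2[OF V, of v]) auto
  qed
  moreover have "cnj S = cnj z * of_real (\<Sum>v\<in>V. (cmod (f v))\<^sup>2)"
    by (simp only: S complex_cnj_mult complex_cnj_complex_of_real)
  ultimately have "cnj z = z" using realS S by (simp del: of_real_sum of_real_power)
  then show ?thesis by (simp add: complex_eq_iff)
qed

text \<open>Turns bounds on the entries of matrix powers into bounds on iterates of the operator on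
  functions.\<close>

lemma kernel_op_funpow:
  assumes V: "finite V" and i: "i < card V"
  shows "((kernel_mat V a ^\<^sub>m k) *\<^sub>v vec (card V) (\<lambda>i. of_real (x (from_nat_into V i)))) $ i
         = of_real ((kernel_op V a ^^ k) x (from_nat_into V i))"
proof -
  have "(kernel_mat V a ^\<^sub>m k) *\<^sub>v vec (card V) (\<lambda>i. complex_of_real (x (from_nat_into V i)))
     = vec (card V) (\<lambda>i. of_real ((kernel_op V a ^^ k) x (from_nat_into V i)))"
  proof (induction k arbitrary: x)
    case 0
    then show ?case by (simp add: kernel_mat_def)
  next
    case (Suc k)
    have "(kernel_mat V a ^\<^sub>m Suc k) *\<^sub>v vec (card V) (\<lambda>i. complex_of_real (x (from_nat_into V i)))
      = (kernel_mat V a ^\<^sub>m k) *\<^sub>v (kernel_mat V a *\<^sub>v vec (card V) (\<lambda>i. of_real (x (from_nat_into V i))))"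
      by (simp, rule assoc_mult_mat_vec[of _ "card V" "card V" _ "card V"]) (simp_all add: pow_carrier_mat)
    also have "kernel_mat V a *\<^sub>v vec (card V) (\<lambda>i. of_real (x (from_nat_into V i)))
       = vec (card V) (\<lambda>i. of_real (kernel_op V a x (from_nat_into V i)))"
      by (subst kernel_mat_mult_vec[OF V, where f = "\<lambda>u. of_real (x u)"]) (simp add: kernel_op_def)
    also have "(kernel_mat V a ^\<^sub>m k) *\<^sub>v \<dots> = vec (card V) (\<lambda>i. of_real ((kernel_op V a ^^ k) (kernel_op V a x) (from_nat_into V i)))"
      by (rule Suc)
    finally show ?case by (simp add: funpow_swap1)
  qed
  then show ?thesis using i by simp
qed

text \<open>A spectral radius below 1 bounds the entries of all powers uniformly, by way of the
  Jordan normal form. The empty \<open>V\<close> is split off because the spectral radius is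
  attained by an eigenvalue only in positive dimension.\<close>

lemma kernel_op_funpow_bounded:
  assumes V: "finite V" and ev: "\<And>z. eigenvalue (kernel_mat V a) z \<Longrightarrow> cmod z < 1"
  obtains C where "\<And>k v. v \<in> V \<Longrightarrow> \<bar>(kernel_op V a ^^ k) x v\<bar> \<le> C"
proof (cases "V = {}")
  case False
  then have n: "0 < card V" using V by (simp add: card_gt_0_iff)
  let ?M = "kernel_mat V a"
  have "spectral_radius ?M \<in> norm ` spectrum ?M"
    by (rule spectral_radius_mem_max[OF kernel_mat_carrier n])
  then have "spectral_radius ?M < 1" using ev by (auto simp: spectrum_def)
  from spectral_radius_jnf_norm_bound_less_1_upper_triangular[OF kernel_mat_carrier this]
  obtain c where c: "\<And>k. norm_bound (?M ^\<^sub>m k) c" by blast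
  have dims: "dim_row (?M ^\<^sub>m k) = card V" "dim_col (?M ^\<^sub>m k) = card V" for k
    by (auto simp: pow_mat_dim_square[OF kernel_mat_carrier])
  show thesis
  proof
    fix k v assume "v \<in> V"
    then obtain i where i: "i < card V" "v = from_nat_into V i"
      using ex_from_nat_into_less_card[OF V] by blast
    have "\<bar>(kernel_op V a ^^ k) x v\<bar> = cmod (of_real ((kernel_op V a ^^ k) x v))" by simp
    also have "\<dots> = cmod (((?M ^\<^sub>m k) *\<^sub>v vec (card V) (\<lambda>i. of_real (x (from_nat_into V i)))) $ i)"
      using kernel_op_funpow[OF V i(1)] i(2) by simp
    also have "\<dots> = cmod (\<Sum>j<card V. (?M ^\<^sub>m k) $$ (i, j) * of_real (x (from_nat_into V j)))"
      using i by (simp add: scalar_prod_def dims atLeast0LessThan)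
    also have "\<dots> \<le> (\<Sum>j<card V. c * \<bar>x (from_nat_into V j)\<bar>)"
    proof (rule sum_norm_le)
      fix j assume "j \<in> {..<card V}"
      then have "cmod ((?M ^\<^sub>m k) $$ (i, j)) \<le> c" using c[of k] i by (simp add: norm_bound_def dims)
      then show "cmod ((?M ^\<^sub>m k) $$ (i, j) * of_real (x (from_nat_into V j))) \<le> c * \<bar>x (from_nat_into V j)\<bar>"
        by (simp add: norm_mult mult_right_mono)
    qed
    finally show "\<bar>(kernel_op V a ^^ k) x v\<bar> \<le> (\<Sum>j<card V. c * \<bar>x (from_nat_into V j)\<bar>)" .
  qed
qed (use that in simp)

lemma kernel_op_self_adjoint:
  assumes "\<And>u v. u \<in> V \<Longrightarrow> v \<in> V \<Longrightarrow> a u v = a v u"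
  shows "(\<Sum>v\<in>V. x v * kernel_op V a y v) = (\<Sum>v\<in>V. kernel_op V a x v * y v)"
proof -
  have "(\<Sum>v\<in>V. x v * kernel_op V a y v) = (\<Sum>v\<in>V. \<Sum>u\<in>V. x v * a v u * y u)"
    by (simp add: kernel_op_def sum_distrib_left mult_ac)
  also have "\<dots> = (\<Sum>u\<in>V. \<Sum>v\<in>V. x v * a v u * y u)" by (rule sum.swap)
  also have "\<dots> = (\<Sum>u\<in>V. \<Sum>v\<in>V. a u v * x v * y u)"
    by (intro sum.cong refl) (simp add: assms)
  also have "\<dots> = (\<Sum>v\<in>V. kernel_op V a x v * y v)"
    by (simp add: kernel_op_def sum_distrib_right)
  finally show ?thesis .
qed

text \<open>By self-adjointness the squared norm of \<open>A y\<close> is the inner product of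
  \<open>y\<close> with \<open>A (A y)\<close>; Cauchy-Schwarz does the rest.\<close>

lemma kernel_op_log_convex:
  assumes sym: "\<And>u v. u \<in> V \<Longrightarrow> v \<in> V \<Longrightarrow> a u v = a v u"
  shows "(\<Sum>v\<in>V. (kernel_op V a y v)\<^sup>2)\<^sup>2
      \<le> (\<Sum>v\<in>V. (y v)\<^sup>2) * (\<Sum>v\<in>V. (kernel_op V a (kernel_op V a y) v)\<^sup>2)"
proof -
  have "(\<Sum>v\<in>V. (kernel_op V a y v)\<^sup>2) = (\<Sum>v\<in>V. y v * kernel_op V a (kernel_op V a y) v)"
    using kernel_op_self_adjoint[where a = a and V = V and x = y and y = "kernel_op V a y", OF sym]
    by (simp add: power2_eq_square)
  then show ?thesis using Cauchy_Schwarz_ineq_sum[of y _ V] by simp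
qed

text \<open>The squared norms of the iterates of a self-adjoint operator are log-convex, so if they stay
  bounded then the operator is a contraction. This replaces diagonalisation.\<close>

lemma kernel_op_contraction:
  assumes V: "finite V" and sym: "\<And>u v. u \<in> V \<Longrightarrow> v \<in> V \<Longrightarrow> a u v = a v u"
    and ev: "\<And>z. eigenvalue (kernel_mat V a) z \<Longrightarrow> cmod z < 1"
  shows "(\<Sum>v\<in>V. (kernel_op V a x v)\<^sup>2) \<le> (\<Sum>v\<in>V. (x v)\<^sup>2)"
proof -
  obtain C where C: "\<And>k v. v \<in> V \<Longrightarrow> \<bar>(kernel_op V a ^^ k) x v\<bar> \<le> C"
    using kernel_op_funpow_bounded[OF V ev] by blast
  define q where "q k = (\<Sum>v\<in>V. ((kernel_op V a ^^ k) x v)\<^sup>2)" for k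
  have "q 1 \<le> q 0"
  proof (rule log_convex_bounded)
    show "0 \<le> q k" for k by (simp add: q_def sum_nonneg)
    show "(q (Suc k))\<^sup>2 \<le> q k * q (Suc (Suc k))" for k
      unfolding q_def by (simp add: kernel_op_log_convex[OF sym])
    show "q k \<le> (\<Sum>v\<in>V. C\<^sup>2)" for k
      unfolding q_def
    proof (rule sum_mono)
      fix v assume "v \<in> V"
      then show "((kernel_op V a ^^ k) x v)\<^sup>2 \<le> C\<^sup>2" using C[of v k] power_mono[of "\<bar>(kernel_op V a ^^ k) x v\<bar>" C 2]
        by simp
    qed
  qed
  then show ?thesis by (simp add: q_def)
qed

text \<open>\<open>kernel_op_contraction\<close> asks for moduli strictly below 1, so the kernel is
  divided by some \<open>b\<close> larger than \<open>c\<close>. Letting \<open>b\<close> decrease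
  to \<open>c\<close> gives the stated constant.\<close>

lemma kernel_op_norm_le:
  assumes V: "finite V" and sym: "\<And>u v. u \<in> V \<Longrightarrow> v \<in> V \<Longrightarrow> a u v = a v u"
    and ev: "\<And>z. eigenvalue (kernel_mat V a) z \<Longrightarrow> cmod z \<le> c" and c: "0 \<le> c"
  shows "(\<Sum>v\<in>V. (kernel_op V a x v)\<^sup>2) \<le> c\<^sup>2 * (\<Sum>v\<in>V. (x v)\<^sup>2)"
proof -
  have scaled: "(\<Sum>v\<in>V. (kernel_op V a x v)\<^sup>2) \<le> b\<^sup>2 * (\<Sum>v\<in>V. (x v)\<^sup>2)" if b: "c < b" for b
  proof -
    have b0: "0 < b" using b c by simp
    have "(\<Sum>v\<in>V. (kernel_op V (\<lambda>u v. a u v / b) x v)\<^sup>2) \<le> (\<Sum>v\<in>V. (x v)\<^sup>2)"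
    proof (rule kernel_op_contraction[OF V])
      fix z assume "eigenvalue (kernel_mat V (\<lambda>u v. a u v / b)) z"
      then obtain f where f: "\<exists>v\<in>V. f v \<noteq> 0"
          "\<And>v. v \<in> V \<Longrightarrow> (\<Sum>u\<in>V. of_real (a v u / b) * f u) = z * f v"
        unfolding eigenvalue_kernel_mat[OF V] by blast
      have "(\<Sum>u\<in>V. of_real (a v u) * f u) = (of_real b * z) * f v" if "v \<in> V" for v
      proof -
        have "(\<Sum>u\<in>V. of_real (a v u) * f u) = of_real b * (\<Sum>u\<in>V. of_real (a v u / b) * f u)"
          using b0 by (simp add: sum_distrib_left)
        then show ?thesis using f(2)[OF that] by simp
      qed
      with f(1) have "eigenvalue (kernel_mat V a) (of_real b * z)"
        unfolding eigenvalue_kernel_mat[OF V] by blast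
      from ev[OF this] have "b * cmod z \<le> c" using b0 by (simp add: norm_mult)
      then have "b * cmod z < b * 1" using b by simp
      then show "cmod z < 1" using b0 by (simp only: mult_less_cancel_left_pos)
    qed (simp add: sym)
    moreover have "kernel_op V (\<lambda>u v. a u v / b) x v = kernel_op V a x v / b" for v
      by (simp add: kernel_op_def sum_divide_distrib)
    ultimately have "(\<Sum>v\<in>V. (kernel_op V a x v)\<^sup>2) / b\<^sup>2 \<le> (\<Sum>v\<in>V. (x v)\<^sup>2)"
      by (simp add: power_divide sum_divide_distrib)
    then show ?thesis using b0 by (simp add: field_simps)
  qed
  have "((\<lambda>b. b\<^sup>2 * (\<Sum>v\<in>V. (x v)\<^sup>2)) \<longlongrightarrow> c\<^sup>2 * (\<Sum>v\<in>V. (x v)\<^sup>2)) (at_right c)"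
    by (intro tendsto_intros)
  then show ?thesis
    by (rule tendsto_lowerbound) (auto simp: eventually_at_filter scaled)
qed

text \<open>The norm bound controls moduli, whereas only an upper bound on the real eigenvalues is
  given. Adding \<open>s\<close> times the identity makes the two agree; Cauchy-Schwarz bounds the
  shifted form, and the shift is subtracted at the end.\<close>

lemma kernel_quadratic_form_le:
  assumes V: "finite V" and sym: "\<And>u v. u \<in> V \<Longrightarrow> v \<in> V \<Longrightarrow> a u v = a v u"
    and ev: "\<And>z. eigenvalue (kernel_mat V a) z \<Longrightarrow> Re z \<le> c"
  shows "(\<Sum>v\<in>V. x v * kernel_op V a x v) \<le> c * (\<Sum>v\<in>V. (x v)\<^sup>2)"
proof -
  have "finite (spectrum (kernel_mat V a))" by (rule card_finite_spectrum[OF kernel_mat_carrier])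
  then have "bdd_above (cmod ` spectrum (kernel_mat V a))" by auto
  then obtain r where r: "\<And>z. eigenvalue (kernel_mat V a) z \<Longrightarrow> cmod z \<le> r"
    unfolding bdd_above_def spectrum_def by auto
  \<comment> \<open>As \<open>r\<close> bounds the moduli of all eigenvalues, this shift moves them
    into the interval from 0 to \<open>c + s\<close>, and it makes \<open>c + s\<close> nonnegative
    in any case.\<close>
  define s where "s = \<bar>r\<bar> + \<bar>c\<bar>"
  define b where "b = (\<lambda>u v. a u v + (if u = v then s else 0))"
  have op: "kernel_op V b y v = kernel_op V a y v + s * y v" if "v \<in> V" for v y
    using that V by (simp add: kernel_op_def b_def distrib_right sum.distrib if_distrib[of "\<lambda>t. t * _"] cong: if_cong)
  have sb: "b u v = b v u" if "u \<in> V" "v \<in> V" for u v using sym that by (auto simp: b_def)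
  have "(\<Sum>v\<in>V. (kernel_op V b x v)\<^sup>2) \<le> (c + s)\<^sup>2 * (\<Sum>v\<in>V. (x v)\<^sup>2)"
  proof (rule kernel_op_norm_le[OF V sb])
    show "0 \<le> c + s" by (simp add: s_def)
    fix z assume z: "eigenvalue (kernel_mat V b) z"
    then obtain f where f: "\<exists>v\<in>V. f v \<noteq> 0"
        "\<And>v. v \<in> V \<Longrightarrow> (\<Sum>u\<in>V. of_real (b v u) * f u) = z * f v"
      unfolding eigenvalue_kernel_mat[OF V] by blast
    have "(\<Sum>u\<in>V. of_real (a v u) * f u) = (z - of_real s) * f v" if v: "v \<in> V" for v
    proof -
      have "(\<Sum>u\<in>V. of_real (b v u) * f u) = (\<Sum>u\<in>V. of_real (a v u) * f u) + of_real s * f v"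
        using v V by (simp add: b_def distrib_right sum.distrib if_distrib[of of_real] if_distrib[of "\<lambda>t. t * _"] cong: if_cong)
      then show ?thesis using f(2)[OF v] by (simp add: algebra_simps)
    qed
    with f(1) have e: "eigenvalue (kernel_mat V a) (z - of_real s)"
      unfolding eigenvalue_kernel_mat[OF V] by blast
    have "z = of_real (Re z)" by (rule kernel_mat_eigenvalue_real[OF V sb z])
    then have "cmod z = \<bar>Re z\<bar>" by (metis norm_of_real)
    moreover have "Re z - s \<le> c" using ev[OF e] by simp
    moreover have "- r \<le> Re z - s"
      using r[OF e] abs_Re_le_cmod[of "z - of_real s"] by simp
    ultimately show "cmod z \<le> c + s" unfolding s_def by linarith
  qed
  then have "(\<Sum>v\<in>V. x v * kernel_op V b x v)\<^sup>2 \<le> ((c + s) * (\<Sum>v\<in>V. (x v)\<^sup>2))\<^sup>2"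
    using Cauchy_Schwarz_ineq_sum[of x "kernel_op V b x" V]
      mult_left_mono[of _ _ "\<Sum>v\<in>V. (x v)\<^sup>2"]
    by (smt (verit) mult.assoc mult.commute power2_eq_square sum_nonneg zero_le_power2)
  moreover have "0 \<le> (c + s) * (\<Sum>v\<in>V. (x v)\<^sup>2)"
    by (intro mult_nonneg_nonneg sum_nonneg) (auto simp: s_def)
  ultimately have "(\<Sum>v\<in>V. x v * kernel_op V b x v) \<le> (c + s) * (\<Sum>v\<in>V. (x v)\<^sup>2)"
    by (rule power2_le_imp_le)
  also have "(\<Sum>v\<in>V. x v * kernel_op V b x v)
    = (\<Sum>v\<in>V. x v * kernel_op V a x v) + s * (\<Sum>v\<in>V. (x v)\<^sup>2)"
    by (simp add: op distrib_left sum.distrib sum_distrib_left power2_eq_square mult_ac)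
  finally show ?thesis by (simp add: distrib_right)
qed

text \<open>The upper bound applied to the negated kernel, whose eigenvalues are the
  negatives.\<close>

lemma kernel_quadratic_form_ge:
  assumes V: "finite V" and sym: "\<And>u v. u \<in> V \<Longrightarrow> v \<in> V \<Longrightarrow> a u v = a v u"
    and ev: "\<And>z. eigenvalue (kernel_mat V a) z \<Longrightarrow> c \<le> Re z"
  shows "c * (\<Sum>v\<in>V. (x v)\<^sup>2) \<le> (\<Sum>v\<in>V. x v * kernel_op V a x v)"
proof -
  have "(\<Sum>v\<in>V. x v * kernel_op V (\<lambda>u v. - a u v) x v) \<le> (- c) * (\<Sum>v\<in>V. (x v)\<^sup>2)"
  proof (rule kernel_quadratic_form_le[OF V])
    fix z assume "eigenvalue (kernel_mat V (\<lambda>u v. - a u v)) z"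
    then have "eigenvalue (kernel_mat V a) (- z)"
      unfolding eigenvalue_kernel_mat[OF V] by (simp add: sum_negf) (metis minus_minus)
    from ev[OF this] show "Re z \<le> - c" by simp
  qed (simp add: sym)
  then show ?thesis by (simp add: kernel_op_def sum_negf)
qed

section \<open>Traces, power sums of eigenvalues and the energy bound\<close>

text \<open>In the \<open>(i, j)\<close> entry of the product a term with middle index
  \<open>l\<close> survives only if \<open>i \<le> l\<close> and \<open>l \<le> j\<close>. Below the
  diagonal none remains, on it only \<open>l = i\<close>.\<close>

lemma upper_triangular_pow:
  assumes B: "B \<in> carrier_mat n n" and ut: "upper_triangular (B :: 'a :: comm_ring_1 mat)"
  shows "upper_triangular (B ^\<^sub>m k) \<and> (\<forall>i<n. (B ^\<^sub>m k) $$ (i, i) = (B $$ (i, i)) ^ k)"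
proof (induction k)
  case 0
  then show ?case using B by (auto simp: upper_triangular_def)
next
  case (Suc k)
  have Bk: "B ^\<^sub>m k \<in> carrier_mat n n" using B by (rule pow_carrier_mat)
  have entry: "(B ^\<^sub>m Suc k) $$ (i, j) = (\<Sum>l<n. (B ^\<^sub>m k) $$ (i, l) * B $$ (l, j))"
    if "i < n" "j < n" for i j
    using that B Bk by (simp add: scalar_prod_def atLeast0LessThan)
  have zero: "(B ^\<^sub>m k) $$ (i, l) * B $$ (l, j) = 0"
    if "i < n" "l < n" "j \<le> i" "\<not> (l = i \<and> j = i)" for i j l
  proof (cases "l < i")
    case True
    then show ?thesis using Suc Bk that by (auto simp: upper_triangular_def)
  next
    case False
    then have "j < l" using that by linarith
    then show ?thesis using ut B that by (auto simp: upper_triangular_def)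
  qed
  have "(B ^\<^sub>m Suc k) $$ (i, j) = 0" if "i < n" "j < i" for i j
    using that zero by (simp add: entry del: pow_mat.simps)
  moreover have "(B ^\<^sub>m Suc k) $$ (i, i) = B $$ (i, i) ^ Suc k" if "i < n" for i
  proof -
    have "(B ^\<^sub>m Suc k) $$ (i, i) = (\<Sum>l\<in>{i}. (B ^\<^sub>m k) $$ (i, l) * B $$ (l, i))"
      unfolding entry[OF that that] by (rule sum.mono_neutral_right) (use that zero in auto)
    then show ?thesis using Suc that by simp
  qed
  moreover have "dim_row (B ^\<^sub>m Suc k) = n" using B by (simp add: pow_mat_dim_square)
  ultimately show ?case by (auto simp: upper_triangular_def simp del: pow_mat.simps)
qed

lemma trace_mult_commute:
  assumes "A \<in> carrier_mat n m" "B \<in> carrier_mat m n"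
  shows "(\<Sum>i<n. (A * B) $$ (i, i)) = (\<Sum>i<m. (B * A) $$ (i, i) :: 'a :: comm_ring_1)"
proof -
  have "(\<Sum>i<n. (A * B) $$ (i, i)) = (\<Sum>i<n. \<Sum>j<m. A $$ (i, j) * B $$ (j, i))"
    using assms by (simp add: scalar_prod_def atLeast0LessThan)
  also have "\<dots> = (\<Sum>j<m. \<Sum>i<n. A $$ (i, j) * B $$ (j, i))" by (rule sum.swap)
  also have "\<dots> = (\<Sum>i<m. (B * A) $$ (i, i))"
    using assms by (simp add: scalar_prod_def atLeast0LessThan mult.commute)
  finally show ?thesis .
qed

text \<open>Schur decomposition gives a similar upper triangular matrix with the eigenvalue list on
  its diagonal. Powers respect the similarity, and the trace is invariant under it.\<close>

lemma eigenvalue_power_sum: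
  assumes A: "A \<in> carrier_mat n n"
  shows "(\<Sum>z\<leftarrow>eigenvalue_list A. z ^ k) = (\<Sum>i<n. (A ^\<^sub>m k) $$ (i, i))"
proof -
  let ?es = "eigenvalue_list A"
  obtain B P Q where "schur_decomposition A ?es = (B, P, Q)"
    by (cases "schur_decomposition A ?es")
  from schur_decomposition[OF A eigenvalue_list(1)[OF A] this]
  have sim: "similar_mat_wit A B P Q" and ut: "upper_triangular B" and diag: "diag_mat B = ?es"
    by auto
  note c = similar_mat_witD2[OF A sim]
  have Bk: "B ^\<^sub>m k \<in> carrier_mat n n" using c by (intro pow_carrier_mat) auto
  have "(\<Sum>i<n. (A ^\<^sub>m k) $$ (i, i)) = (\<Sum>i<n. (P * (B ^\<^sub>m k * Q)) $$ (i, i))"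
    using similar_mat_wit_pow_id[OF sim, of k] c Bk by (simp add: assoc_mult_mat)
  also have "\<dots> = (\<Sum>i<n. (B ^\<^sub>m k * Q * P) $$ (i, i))"
    by (rule trace_mult_commute[OF c(6)]) (use c Bk in auto)
  also have "B ^\<^sub>m k * Q * P = B ^\<^sub>m k"
    using c Bk by (subst assoc_mult_mat[OF Bk c(7) c(6)]) simp
  also have "(\<Sum>i<n. (B ^\<^sub>m k) $$ (i, i)) = (\<Sum>i<n. (B $$ (i, i)) ^ k)"
    using upper_triangular_pow[OF _ ut, of n k] c by simp
  also have "\<dots> = (\<Sum>z\<leftarrow>diag_mat B. z ^ k)"
    using c by (simp add: diag_mat_def interv_sum_list_conv_sum_set_nat atLeast0LessThan o_def)
  finally show ?thesis using diag by simp
qed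

lemma set_eigenvalue_list:
  assumes A: "A \<in> carrier_mat n n"
  shows "set (eigenvalue_list A) = spectrum A"
  by (auto simp: spectrum_root_char_poly[OF A] eigenvalue_list(1)[OF A] poly_prod_list o_def
      prod_list_zero_iff)

section \<open>Traces of the first three powers of a kernel matrix\<close>

lemma kernel_mat_pow2_trace:
  "(\<Sum>z\<leftarrow>eigenvalue_list (kernel_mat V a). z ^ 2) = of_real (\<Sum>v\<in>V. \<Sum>u\<in>V. a v u * a u v)"
proof -
  let ?e = "from_nat_into V" and ?n = "card V"
  have "(\<Sum>z\<leftarrow>eigenvalue_list (kernel_mat V a). z ^ 2)
    = (\<Sum>i<?n. \<Sum>j<?n. of_real (a (?e i) (?e j)) * of_real (a (?e j) (?e i)))"
    unfolding eigenvalue_power_sum[OF kernel_mat_carrier] numeral_2_eq_2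
    by (simp add: kernel_mat_def scalar_prod_def atLeast0LessThan)
  also have "\<dots> = (\<Sum>i<?n. \<Sum>u\<in>V. of_real (a (?e i) u) * of_real (a u (?e i)))"
    by (intro sum.cong refl
      sum.card_from_nat_into[where h = "\<lambda>u. of_real (a (?e _) u) * of_real (a u (?e _))"])
  also have "\<dots> = (\<Sum>v\<in>V. \<Sum>u\<in>V. of_real (a v u) * of_real (a u v))"
    by (rule sum.card_from_nat_into[where h = "\<lambda>v. \<Sum>u\<in>V. of_real (a v u) * of_real (a u v)"])
  finally show ?thesis by simp
qed

lemma kernel_mat_trace:
  "(\<Sum>z\<leftarrow>eigenvalue_list (kernel_mat V a). z) = of_real (\<Sum>v\<in>V. a v v)"
proof -
  let ?e = "from_nat_into V" and ?n = "card V"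
  have "(\<Sum>z\<leftarrow>eigenvalue_list (kernel_mat V a). z) = (\<Sum>i<?n. of_real (a (?e i) (?e i)))"
    using eigenvalue_power_sum[OF kernel_mat_carrier[of V a], of 1]
    by (simp add: kernel_mat_def)
  also have "\<dots> = (\<Sum>v\<in>V. of_real (a v v))"
    by (rule sum.card_from_nat_into[where h = "\<lambda>v. of_real (a v v)"])
  finally show ?thesis by simp
qed

lemma kernel_mat_pow3_trace:
  "(\<Sum>z\<leftarrow>eigenvalue_list (kernel_mat V a). z ^ 3)
       = of_real (\<Sum>v\<in>V. \<Sum>u\<in>V. \<Sum>w\<in>V. a v w * a w u * a u v)"
proof -
  let ?e = "from_nat_into V" and ?n = "card V"
  have "(\<Sum>z\<leftarrow>eigenvalue_list (kernel_mat V a). z ^ 3)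
    = (\<Sum>i<?n. \<Sum>j<?n. (\<Sum>k<?n. of_real (a (?e i) (?e k)) * of_real (a (?e k) (?e j))) * of_real (a (?e j) (?e i)))"
    unfolding eigenvalue_power_sum[OF kernel_mat_carrier] numeral_3_eq_3
    by (simp add: kernel_mat_def scalar_prod_def atLeast0LessThan)
  also have "\<dots> = (\<Sum>i<?n. \<Sum>j<?n. (\<Sum>w\<in>V. of_real (a (?e i) w) * of_real (a w (?e j))) * of_real (a (?e j) (?e i)))"
    by (intro sum.cong refl arg_cong2[where f = times]
      sum.card_from_nat_into[where h = "\<lambda>w. of_real (a (?e _) w) * of_real (a w (?e _))"])
  also have "\<dots> = (\<Sum>i<?n. \<Sum>u\<in>V. (\<Sum>w\<in>V. of_real (a (?e i) w) * of_real (a w u)) * of_real (a u (?e i)))"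
    by (intro sum.cong refl
      sum.card_from_nat_into[where h = "\<lambda>u. (\<Sum>w\<in>V. of_real (a (?e _) w) * of_real (a w u)) * of_real (a u (?e _))"])
  also have "\<dots> = (\<Sum>v\<in>V. \<Sum>u\<in>V. (\<Sum>w\<in>V. of_real (a v w) * of_real (a w u)) * of_real (a u v))"
    by (rule sum.card_from_nat_into[where h = "\<lambda>v. \<Sum>u\<in>V. (\<Sum>w\<in>V. of_real (a v w) * of_real (a w u)) * of_real (a u v)"])
  finally show ?thesis by (simp add: sum_distrib_right)
qed

section \<open>The product of the nonzero eigenvalues and the logarithmic bound\<close>

lemma length_filter_nonzero:
  "length (filter (\<lambda>z. z \<noteq> 0) L) + count_list L 0 = length L"
  by (induction L) auto

text \<open>The order of the symmetric function is the number of nonzero eigenvalues. The set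
  \<open>J\<close> of their positions is therefore the only index set of that size whose product
  does not vanish.\<close>

lemma norm_Upsilon_nonzero:
  assumes A: "A \<in> carrier_mat n n"
  defines "L \<equiv> eigenvalue_list A"
  shows "cmod (Upsilon (n - count_list L 0) A) = (\<Prod>z\<leftarrow>filter (\<lambda>z. z \<noteq> 0) L. cmod z)"
proof -
  define J where "J = {i. i < n \<and> L ! i \<noteq> 0}"
  have len: "length L = n" unfolding L_def by (rule eigenvalue_list(2)[OF A])
  have count: "count_list L 0 + length (filter (\<lambda>z. z \<noteq> 0) L) = n"
    using length_filter_nonzero[of L] len by simp
  then have cJ: "card J = n - count_list L 0"
    using len by (simp add: J_def length_filter_conv_card)
  have "Upsilon (n - count_list L 0) A
    = (\<Sum>I\<in>{I. I \<subseteq> {..<n} \<and> card I = n - count_list L 0}. \<Prod>i\<in>I. L ! i)"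
    unfolding Upsilon_def L_def using A by simp
  also have "\<dots> = (\<Sum>I\<in>{J}. \<Prod>i\<in>I. L ! i)"
  proof (rule sum.mono_neutral_right)
    have "{I. I \<subseteq> {..<n} \<and> card I = n - count_list L 0} \<subseteq> Pow {..<n}" by blast
    then show "finite {I. I \<subseteq> {..<n} \<and> card I = n - count_list L 0}"
      by (rule finite_subset) simp
    show "{J} \<subseteq> {I. I \<subseteq> {..<n} \<and> card I = n - count_list L 0}"
      using cJ by (auto simp: J_def)
    show "\<forall>I\<in>{I. I \<subseteq> {..<n} \<and> card I = n - count_list L 0} - {J}. (\<Prod>i\<in>I. L ! i) = 0"
    proof
      fix I assume I: "I \<in> {I. I \<subseteq> {..<n} \<and> card I = n - count_list L 0} - {J}"
      have finI: "finite I" using I finite_subset[of I "{..<n}"] by blast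
      \<comment> \<open>A different set of the same finite size cannot lie inside \<open>J\<close>,
        so it picks up a zero eigenvalue.\<close>
      have "\<not> I \<subseteq> J" using I cJ card_subset_eq[of J I] by (auto simp: J_def)
      then obtain i where "i \<in> I" "L ! i = 0" using I by (auto simp: J_def)
      then show "(\<Prod>i\<in>I. L ! i) = 0" using finI by (auto simp: prod_zero_iff)
    qed
  qed
  also have "\<dots> = (\<Prod>i\<in>J. L ! i)" by simp
  also have "cmod \<dots> = (\<Prod>i\<in>J. cmod (L ! i))" by (simp add: prod_norm)
  also have "\<dots> = (\<Prod>i<n. if L ! i \<noteq> 0 then cmod (L ! i) else 1)"
    by (auto simp: J_def prod.If_cases intro!: prod.cong)
  also have "\<dots> = (\<Prod>z\<leftarrow>L. if z \<noteq> 0 then cmod z else 1)"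
    using len by (simp add: prod.list_conv_set_nth atLeast0LessThan)
  also have "\<dots> = (\<Prod>z\<leftarrow>filter (\<lambda>z. z \<noteq> 0) L. cmod z)"
    by (induction L) auto
  finally show ?thesis .
qed

text \<open>Summing \<open>ln t \<le> t - 1\<close> over the moduli of the nonzero entries; zeros
  add nothing to either side, and equality in one term means \<open>t = 1\<close>.\<close>

lemma sum_norm_ge_ln:
  fixes L :: "complex list"
  defines "F \<equiv> filter (\<lambda>z. z \<noteq> 0) L"
  shows "(\<Sum>z\<leftarrow>L. cmod z) \<ge> real (length F) + ln (\<Prod>z\<leftarrow>F. cmod z)"
    and "(\<Sum>z\<leftarrow>L. cmod z) = real (length F) + ln (\<Prod>z\<leftarrow>F. cmod z)
      \<longleftrightarrow> (\<forall>z\<in>set L. z = 0 \<or> cmod z = 1)"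
proof -
  \<comment> \<open>Both claims go through one induction: equality for a longer list splits into
    equality for the head and for the tail only because the inequality holds for each.\<close>
  have "real (length (filter (\<lambda>z. z \<noteq> 0) L)) + ln (\<Prod>z\<leftarrow>filter (\<lambda>z. z \<noteq> 0) L. cmod z) \<le> (\<Sum>z\<leftarrow>L. cmod z) \<and>
    ((\<Sum>z\<leftarrow>L. cmod z) = real (length (filter (\<lambda>z. z \<noteq> 0) L)) + ln (\<Prod>z\<leftarrow>filter (\<lambda>z. z \<noteq> 0) L. cmod z)
      \<longleftrightarrow> (\<forall>z\<in>set L. z = 0 \<or> cmod z = 1))"
  proof (induction L)
    case (Cons z L)
    have pos: "0 < (\<Prod>z\<leftarrow>filter (\<lambda>z. z \<noteq> 0) L. cmod z)" by (induction L) auto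
    show ?case
    proof (cases "z = 0")
      case False
      then have z: "0 < cmod z" by simp
      have ln: "ln (cmod z) \<le> cmod z - 1" using z by (rule ln_le_minus_one)
      have eq: "cmod z = 1" if "ln (cmod z) = cmod z - 1"
        using ln_eq_minus_one[OF z that] .
      have ln_prod: "ln (cmod z * (\<Prod>z\<leftarrow>filter (\<lambda>z. z \<noteq> 0) L. cmod z))
        = ln (cmod z) + ln (\<Prod>z\<leftarrow>filter (\<lambda>z. z \<noteq> 0) L. cmod z)"
        by (rule ln_mult_pos[OF z pos])
      show ?thesis using Cons.IH ln eq False ln_prod
        by (auto simp del: prod_list_zero_iff)
    qed (use Cons.IH in simp)
  qed simp
  then show "(\<Sum>z\<leftarrow>L. cmod z) \<ge> real (length F) + ln (\<Prod>z\<leftarrow>F. cmod z)"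
    and "(\<Sum>z\<leftarrow>L. cmod z) = real (length F) + ln (\<Prod>z\<leftarrow>F. cmod z)
      \<longleftrightarrow> (\<forall>z\<in>set L. z = 0 \<or> cmod z = 1)" by (auto simp: F_def)
qed

lemma sum_list_remove1:
  fixes f :: "'a \<Rightarrow> 'b :: ab_group_add"
  assumes "x \<in> set L"
  shows "(\<Sum>z\<leftarrow>L. f z) = f x + (\<Sum>z\<leftarrow>remove1 x L. f z)"
  using assms by (induction L) (auto simp: algebra_simps)

text \<open>One copy of \<open>\<rho>\<close> contributes its exact value instead of
  \<open>1 + ln \<rho>\<close>. Further copies stay in the list, so for \<open>\<rho> > 1\<close>
  equality forces \<open>\<rho>\<close> to be simple.\<close>

lemma sum_norm_ge_ln_remove1:
  fixes L :: "complex list"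
  assumes \<rho>: "0 < \<rho>" "complex_of_real \<rho> \<in> set L"
  defines "N \<equiv> real (length L) - real (count_list L 0)"
    and "P \<equiv> \<Prod>z\<leftarrow>filter (\<lambda>z. z \<noteq> 0) L. cmod z"
  shows "(\<Sum>z\<leftarrow>L. cmod z) \<ge> \<rho> + N - 1 + ln P - ln \<rho>"
    and "(\<Sum>z\<leftarrow>L. cmod z) = \<rho> + N - 1 + ln P - ln \<rho>
      \<longleftrightarrow> (\<forall>z\<in>set (remove1 (of_real \<rho>) L). z = 0 \<or> cmod z = 1)"
proof -
  let ?r = "complex_of_real \<rho>"
  define L' where "L' = remove1 ?r L"
  define F where "F = filter (\<lambda>z. z \<noteq> 0) L'"
  have sum: "(\<Sum>z\<leftarrow>L. cmod z) = \<rho> + (\<Sum>z\<leftarrow>L'. cmod z)"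
    using sum_list_remove1[OF \<rho>(2), of cmod] \<rho>(1) by (simp add: L'_def)
  have "length (filter (\<lambda>z. z \<noteq> 0) L) = Suc (length F) \<and> P = \<rho> * (\<Prod>z\<leftarrow>F. cmod z)"
    using \<rho> unfolding P_def F_def L'_def by (induction L) auto
  moreover have "0 < (\<Prod>z\<leftarrow>F. cmod z)" unfolding F_def by (induction L') auto
  ultimately have "N = 1 + real (length F)" "ln P = ln \<rho> + ln (\<Prod>z\<leftarrow>F. cmod z)"
    using length_filter_nonzero[of L] \<rho>(1) by (auto simp: N_def ln_mult_pos simp del: prod_list_zero_iff)
  then have *: "\<rho> + N - 1 + ln P - ln \<rho> = \<rho> + (real (length F) + ln (\<Prod>z\<leftarrow>F. cmod z))" by simp
  show "(\<Sum>z\<leftarrow>L. cmod z) \<ge> \<rho> + N - 1 + ln P - ln \<rho>"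
    and "(\<Sum>z\<leftarrow>L. cmod z) = \<rho> + N - 1 + ln P - ln \<rho>
      \<longleftrightarrow> (\<forall>z\<in>set (remove1 (of_real \<rho>) L). z = 0 \<or> cmod z = 1)"
    unfolding * sum using sum_norm_ge_ln[of L'] by (auto simp: F_def L'_def)
qed

section \<open>Spectra of graphs and \<open>k\<close>-degrees\<close>

lemma adjacent_sym: "adjacent G u v \<longleftrightarrow> adjacent G v u"
  by (simp add: adjacent_def insert_commute)

lemma adjacentD:
  assumes "simple_graph G" "adjacent G u v"
  shows "u \<in> verts G" "v \<in> verts G" "u \<noteq> v"
proof -
  have "{u, v} \<subseteq> verts G \<and> card {u, v} = 2" using assms by (auto simp: simple_graph_def adjacent_def)
  then show "u \<in> verts G" "v \<in> verts G" "u \<noteq> v" by auto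
qed

lemma neighbours_iff: "simple_graph G \<Longrightarrow> u \<in> neighbours G v \<longleftrightarrow> adjacent G v u"
  using adjacentD(2) by (fastforce simp: neighbours_def)

lemma finite_verts: "simple_graph G \<Longrightarrow> finite (verts G)"
  by (simp add: simple_graph_def)

lemma neighbours_subset: "neighbours G v \<subseteq> verts G"
  by (auto simp: neighbours_def)

lemma finite_neighbours: "simple_graph G \<Longrightarrow> finite (neighbours G v)"
  using neighbours_subset finite_verts by (rule finite_subset)

lemma self_notin_neighbours: "simple_graph G \<Longrightarrow> v \<notin> neighbours G v"
  using adjacentD(3) by (fastforce simp: neighbours_iff)

abbreviation adj_kernel :: "'a ugraph \<Rightarrow> 'a \<Rightarrow> 'a \<Rightarrow> real" where
  "adj_kernel G u v \<equiv> of_bool (adjacent G u v)"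

lemma adj_matrix_kernel: "adj_matrix G = kernel_mat (verts G) (adj_kernel G)"
  unfolding adj_matrix_def kernel_mat_def by (rule eq_matI) auto

lemma adj_matrix_carrier: "adj_matrix G \<in> carrier_mat (card (verts G)) (card (verts G))"
  by (simp add: adj_matrix_kernel)

lemma sum_adj_eq_neighbours:
  fixes f :: "'a \<Rightarrow> 'b :: semiring_1"
  assumes "simple_graph G"
  shows "(\<Sum>u\<in>verts G. of_bool (adjacent G v u) * f u) = (\<Sum>u\<in>neighbours G v. f u)"
  using finite_verts[OF assms]
  by (simp add: neighbours_def of_bool_def if_distrib[of "\<lambda>t. t * _"] sum.inter_filter cong: if_cong)

lemma of_real_of_bool_eq: "(of_real (of_bool P) :: 'a :: real_algebra_1) = of_bool P"
  by simp

lemma eigenvalue_adj_matrix: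
  assumes G: "simple_graph G"
  shows "eigenvalue (adj_matrix G) z \<longleftrightarrow>
    (\<exists>f. (\<exists>v\<in>verts G. f v \<noteq> 0) \<and> (\<forall>v\<in>verts G. (\<Sum>u\<in>neighbours G v. f u) = z * f v))"
  by (simp add: sum_adj_eq_neighbours[OF G] of_real_of_bool_eq adj_matrix_kernel eigenvalue_kernel_mat[OF finite_verts[OF G]])

lemma adj_eigenvalue_real:
  assumes "simple_graph G" "eigenvalue (adj_matrix G) z"
  shows "z = of_real (Re z)"
  using kernel_mat_eigenvalue_real[OF finite_verts[OF assms(1)], of "adj_kernel G" z] assms(2) adjacent_sym[of G]
  by (simp add: adj_matrix_kernel)

lemma adj_trace1:
  assumes "simple_graph G"
  shows "(\<Sum>z\<leftarrow>eigenvalue_list (adj_matrix G). z) = 0"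
proof -
  have "\<not> adjacent G v v" for v using adjacentD(3)[OF assms] by blast
  then show ?thesis unfolding adj_matrix_kernel kernel_mat_trace by simp
qed

lemma adj_trace2:
  assumes G: "simple_graph G"
  shows "(\<Sum>z\<leftarrow>eigenvalue_list (adj_matrix G). z ^ 2) = of_nat (\<Sum>v\<in>verts G. card (neighbours G v))"
proof -
  have "(\<Sum>v\<in>verts G. \<Sum>u\<in>verts G. adj_kernel G v u * adj_kernel G u v)
      = (\<Sum>v\<in>verts G. \<Sum>u\<in>verts G. adj_kernel G v u * 1)"
    by (intro sum.cong refl) (simp add: adjacent_sym)
  also have "\<dots> = (\<Sum>v\<in>verts G. \<Sum>u\<in>neighbours G v. 1)"
    by (subst sum_adj_eq_neighbours[OF G]) simp
  finally show ?thesis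
    unfolding adj_matrix_kernel kernel_mat_pow2_trace by simp
qed

text \<open>Closed walks of length 3 from \<open>v\<close> are counted by the neighbour
  \<open>u\<close> visited last and a common neighbour of \<open>u\<close> and
  \<open>v\<close>.\<close>

lemma adj_trace3:
  assumes G: "simple_graph G"
  shows "(\<Sum>z\<leftarrow>eigenvalue_list (adj_matrix G). z ^ 3)
    = of_nat (\<Sum>v\<in>verts G. \<Sum>u\<in>neighbours G v. card (neighbours G v \<inter> neighbours G u))"
proof -
  have "(\<Sum>w\<in>verts G. adj_kernel G v w * adj_kernel G w u * adj_kernel G u v)
     = adj_kernel G v u * real (card (neighbours G v \<inter> neighbours G u))" for u v
  proof -
    have "(\<Sum>w\<in>verts G. adj_kernel G v w * adj_kernel G w u * adj_kernel G u v)
      = (\<Sum>w\<in>verts G. adj_kernel G v w * (adj_kernel G u w * adj_kernel G v u))"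
      by (intro sum.cong refl) (simp add: adjacent_sym)
    also have "\<dots> = (\<Sum>w\<in>neighbours G v. adj_kernel G u w * adj_kernel G v u)"
      by (rule sum_adj_eq_neighbours[OF G])
    also have "\<dots> = adj_kernel G v u * (\<Sum>w\<in>neighbours G v. of_bool (w \<in> neighbours G u))"
      by (simp add: sum_distrib_left neighbours_iff[OF G] mult.commute)
    also have "(\<Sum>w\<in>neighbours G v. of_bool (w \<in> neighbours G u)) = real (card (neighbours G v \<inter> neighbours G u))"
      by (simp add: finite_neighbours[OF G] Int_def)
    finally show ?thesis .
  qed
  then show ?thesis
    unfolding adj_matrix_kernel kernel_mat_pow3_trace
    by (simp add: sum_adj_eq_neighbours[OF G])
qed

section \<open>Edge counts and the growth of the \<open>k\<close>-degrees\<close>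

lemma double_card_edges_le:
  assumes G: "simple_graph G"
  shows "2 * card (edges G) \<le> (\<Sum>v\<in>verts G. card (neighbours G v))"
proof -
  have finE: "finite (edges G)"
    using G finite_subset[of "edges G" "Pow (verts G)"] by (auto simp: simple_graph_def)
  have "2 * card (edges G) = (\<Sum>v\<in>verts G. card {e \<in> edges G. v \<in> e})"
  proof (subst sum_multicount_gen[where k = "\<lambda>_. 2"])
    show "\<forall>e\<in>edges G. card {v \<in> verts G. v \<in> e} = 2"
    proof
      fix e assume "e \<in> edges G"
      then have "e \<subseteq> verts G" "card e = 2" using G by (auto simp: simple_graph_def)
      then show "card {v \<in> verts G. v \<in> e} = 2" by (metis Collect_mem_eq Int_def inf.absorb_iff2)
    qed
  qed (use finE finite_verts[OF G] in auto)
  also have "\<dots> \<le> (\<Sum>v\<in>verts G. card (neighbours G v))"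
  proof (rule sum_mono)
    fix v assume "v \<in> verts G"
    \<comment> \<open>Every edge at \<open>v\<close> has the form \<open>{v, u}\<close> with a
      neighbour \<open>u\<close>, so there are at most as many edges at \<open>v\<close> as
      neighbours.\<close>
    have "{e \<in> edges G. v \<in> e} \<subseteq> (\<lambda>u. {v, u}) ` neighbours G v"
    proof
      fix e assume e: "e \<in> {e \<in> edges G. v \<in> e}"
      then have "card e = 2" using G by (auto simp: simple_graph_def)
      then obtain x y where "e = {x, y}" by (auto simp: card_2_iff)
      with e obtain u where "e = {v, u}" by auto
      then show "e \<in> (\<lambda>u. {v, u}) ` neighbours G v"
        using e by (auto simp: neighbours_iff[OF G] adjacent_def)
    qed
    then show "card {e \<in> edges G. v \<in> e} \<le> card (neighbours G v)"
      using finite_neighbours[OF G] by (meson card_image_le card_mono finite_imageI le_trans)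
  qed
  finally show ?thesis .
qed

text \<open>This is the squared norm of the \<open>k\<close>-th iterate of the adjacency operator on
  the constant function 1, which is what makes the operator results applicable.\<close>

abbreviation kdegree_sq_sum :: "'a ugraph \<Rightarrow> nat \<Rightarrow> real" where
  "kdegree_sq_sum G k \<equiv> (\<Sum>i\<in>verts G. (real (kdegree G k i))\<^sup>2)"

lemma kdegree_ratio_eq: "kdegree_ratio G k = sqrt (kdegree_sq_sum G (Suc k) / kdegree_sq_sum G k)"
  by (simp add: kdegree_ratio_def)

lemma kernel_op_adj:
  assumes "simple_graph G"
  shows "kernel_op (verts G) (adj_kernel G) x v = (\<Sum>u\<in>neighbours G v. x u)"
  unfolding kernel_op_def by (rule sum_adj_eq_neighbours[OF assms])

lemma kernel_op_kdegree:
  assumes "simple_graph G"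
  shows "kernel_op (verts G) (adj_kernel G) (\<lambda>u. real (kdegree G k u)) = (\<lambda>u. real (kdegree G (Suc k) u))"
  by (rule ext) (simp add: kernel_op_adj[OF assms])

lemma kdegree_sq_sum_log_convex:
  assumes "simple_graph G"
  shows "(kdegree_sq_sum G (Suc k))\<^sup>2 \<le> kdegree_sq_sum G k * kdegree_sq_sum G (Suc (Suc k))"
  using kernel_op_log_convex[where V = "verts G" and a = "adj_kernel G" and y = "\<lambda>u. real (kdegree G k u)"]
  by (simp only: kernel_op_kdegree[OF assms] adjacent_sym)

lemma kdegree_sq_sum_le:
  assumes "simple_graph G" "\<And>z. eigenvalue (adj_matrix G) z \<Longrightarrow> cmod z \<le> \<rho>" "0 \<le> \<rho>"
  shows "kdegree_sq_sum G (Suc k) \<le> \<rho>\<^sup>2 * kdegree_sq_sum G k"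
  using kernel_op_norm_le[OF finite_verts[OF assms(1)], of "adj_kernel G" \<rho> "\<lambda>u. real (kdegree G k u)"]
    assms(2,3) adjacent_sym[of G]
  by (simp add: adj_matrix_kernel kernel_op_kdegree[OF assms(1)] del: kdegree.simps)

lemma kdegree_ratio_le:
  assumes "simple_graph G" "\<And>z. eigenvalue (adj_matrix G) z \<Longrightarrow> cmod z \<le> \<rho>" "0 \<le> \<rho>"
  shows "kdegree_ratio G k \<le> \<rho>"
proof -
  have "0 \<le> kdegree_sq_sum G k" by (simp add: sum_nonneg)
  then have "kdegree_sq_sum G (Suc k) / kdegree_sq_sum G k \<le> \<rho>\<^sup>2"
    using kdegree_sq_sum_le[OF assms, of k]
    \<comment> \<open>A zero denominator makes the quotient 0, and the bound still holds.\<close>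
    by (cases "kdegree_sq_sum G k = 0") (auto simp: divide_le_eq simp del: kdegree.simps)
  then show ?thesis unfolding kdegree_ratio_eq using assms(3) real_le_lsqrt by blast
qed

text \<open>Comparing an eigenvector with its entry of largest modulus replaces the
  Perron--Frobenius theorem here.\<close>

lemma kdegree_ge_eigenvalue_power:
  assumes G: "simple_graph G" and z: "eigenvalue (adj_matrix G) z"
  shows "\<exists>v\<in>verts G. \<forall>k. cmod z ^ k \<le> real (kdegree G k v)"
proof -
  obtain f w where f: "w \<in> verts G" "f w \<noteq> 0"
      "\<And>v. v \<in> verts G \<Longrightarrow> (\<Sum>u\<in>neighbours G v. f u) = z * f v"
    using z unfolding eigenvalue_adj_matrix[OF G] by blast
  define M where "M = Max ((\<lambda>v. cmod (f v)) ` verts G)"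
  have fin: "finite ((\<lambda>v. cmod (f v)) ` verts G)" using finite_verts[OF G] by simp
  have le_M: "cmod (f v) \<le> M" if "v \<in> verts G" for v
    unfolding M_def using that fin by simp
  have "M \<in> (\<lambda>v. cmod (f v)) ` verts G" unfolding M_def using f(1) fin by (intro Max_in) auto
  then obtain v0 where v0: "v0 \<in> verts G" "cmod (f v0) = M" by auto
  have "0 < M" using le_M[OF f(1)] f(2) by (smt (verit) zero_less_norm_iff)
  have "cmod z ^ k * cmod (f v) \<le> real (kdegree G k v) * M" if "v \<in> verts G" for k v
    using that
  proof (induction k arbitrary: v)
    case 0
    then show ?case using le_M by simp
  next
    case (Suc k)
    have "cmod z ^ Suc k * cmod (f v) = cmod z ^ k * cmod (\<Sum>u\<in>neighbours G v. f u)"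
      using f(3)[OF Suc.prems] by (simp add: norm_mult)
    also have "\<dots> \<le> cmod z ^ k * (\<Sum>u\<in>neighbours G v. cmod (f u))"
      by (intro mult_left_mono norm_sum) simp
    also have "\<dots> \<le> (\<Sum>u\<in>neighbours G v. real (kdegree G k u) * M)"
      unfolding sum_distrib_left
      by (intro sum_mono Suc.IH subsetD[OF neighbours_subset])
    also have "\<dots> = real (kdegree G (Suc k) v) * M" by (simp add: sum_distrib_right)
    finally show ?case .
  qed
  from this[OF v0(1)] show ?thesis using v0 \<open>0 < M\<close> by (auto intro!: bexI[of _ v0])
qed

text \<open>The square of the ratio is the mean of the squared degrees. A natural number is at most
  its square, so this is at least the mean degree, hence at least \<open>dense\<close>'s
  quotient.\<close>

lemma kdegree_ratio_0_ge_1: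
  assumes G: "simple_graph G" and dense: "1 \<le> 2 * real (card (edges G)) / real (card (verts G))"
  shows "1 \<le> kdegree_ratio G 0"
proof -
  \<comment> \<open>Without vertices the quotient in \<open>dense\<close> would be a division by 0,
    with value 0.\<close>
  have n: "0 < card (verts G)" using dense by (cases "card (verts G)") auto
  have "real (card (verts G)) \<le> real (2 * card (edges G))"
    using dense n by (simp add: le_divide_eq)
  also have "\<dots> \<le> real (\<Sum>v\<in>verts G. card (neighbours G v))"
    using double_card_edges_le[OF G] of_nat_mono by blast
  also have "\<dots> \<le> kdegree_sq_sum G 1"
    by (simp add: self_le_power sum_mono of_nat_0_less_iff power2_eq_square flip: of_nat_mult)
  finally have "real (card (verts G)) \<le> kdegree_sq_sum G 1" .
  moreover have "0 < real (card (verts G))" using n by simp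
  ultimately have "1 \<le> kdegree_sq_sum G 1 / real (card (verts G))"
    by (simp only: le_divide_eq_1_pos)
  then show ?thesis using n by (simp add: kdegree_ratio_eq)
qed

lemma kdegree_sq_sum_pos:
  assumes G: "simple_graph G" and "1 \<le> kdegree_ratio G 0"
  shows "0 < kdegree_sq_sum G 0" "0 < kdegree_sq_sum G 1"
proof -
  have nn: "0 \<le> kdegree_sq_sum G j" for j by (simp add: sum_nonneg)
  \<comment> \<open>Division by 0 yields 0, so a nonzero quotient shows that numerator and
    denominator are both nonzero.\<close>
  have "kdegree_sq_sum G (Suc 0) / kdegree_sq_sum G 0 \<noteq> 0"
  proof
    assume "kdegree_sq_sum G (Suc 0) / kdegree_sq_sum G 0 = 0"
    then have "kdegree_ratio G 0 = 0" by (simp only: kdegree_ratio_eq real_sqrt_zero)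
    then show False using assms(2) by simp
  qed
  then have "kdegree_sq_sum G 0 \<noteq> 0" "kdegree_sq_sum G 1 \<noteq> 0"
    by (simp_all only: divide_eq_0_iff One_nat_def) blast+
  then show "0 < kdegree_sq_sum G 0" "0 < kdegree_sq_sum G 1"
    using nn[of 0] nn[of 1] by linarith+
qed

lemma incseq_kdegree_ratio:
  assumes G: "simple_graph G" and "1 \<le> kdegree_ratio G 0"
  shows "incseq (kdegree_ratio G)"
proof -
  have "incseq (\<lambda>k. kdegree_sq_sum G (Suc k) / kdegree_sq_sum G k)"
    by (rule log_convex_ratio(2))
      (use kdegree_sq_sum_log_convex[OF G] kdegree_sq_sum_pos[OF assms] in
        \<open>auto intro: sum_nonneg simp del: kdegree.simps\<close>)
  then show ?thesis by (simp only: mono_def kdegree_ratio_eq real_sqrt_le_iff)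
qed

text \<open>The ratios increase to some limit \<open>L\<close> with \<open>L \<le> \<rho>\<close>.
  If \<open>L\<close> were smaller, the squared norms would grow at most like the powers of
  \<open>L\<^sup>2\<close>, while a single vertex whose \<open>k\<close>-degree is at least
  \<open>\<rho> ^ k\<close> for every \<open>k\<close> makes them grow at least like the powers of
  \<open>\<rho>\<^sup>2\<close>.\<close>

lemma kdegree_ratio_tendsto:
  assumes G: "simple_graph G" and ge1: "1 \<le> kdegree_ratio G 0"
    and ev: "\<And>z. eigenvalue (adj_matrix G) z \<Longrightarrow> cmod z \<le> \<rho>"
    and \<rho>: "eigenvalue (adj_matrix G) z" "cmod z = \<rho>"
  shows "kdegree_ratio G \<longlonglongrightarrow> \<rho>"
proof -
  let ?s = "kdegree_sq_sum G"
  have \<rho>0: "0 \<le> \<rho>" using \<rho>(2) by auto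
  have le: "kdegree_ratio G k \<le> \<rho>" for k by (rule kdegree_ratio_le[OF G ev \<rho>0])
  obtain L where L: "kdegree_ratio G \<longlonglongrightarrow> L" "\<And>k. kdegree_ratio G k \<le> L"
    using incseq_convergent[OF incseq_kdegree_ratio[OF G ge1], of \<rho>] le by blast
  have "L \<le> \<rho>" using LIMSEQ_le_const2[OF L(1)] le by blast
  moreover have "\<not> L < \<rho>"
  proof
    assume lt: "L < \<rho>"
    have L1: "1 \<le> L" using L(2)[of 0] ge1 by simp
    have pos: "0 < ?s k" for k
      by (rule log_convex_ratio(1))
        (use kdegree_sq_sum_log_convex[OF G] kdegree_sq_sum_pos[OF G ge1] in
          \<open>auto intro: sum_nonneg simp del: kdegree.simps\<close>)
    have step: "?s (Suc k) \<le> L\<^sup>2 * ?s k" for k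
    proof -
      have "0 \<le> ?s (Suc k) / ?s k" using pos[of k] pos[of "Suc k"] by (simp del: kdegree.simps)
      then have "?s (Suc k) / ?s k = (kdegree_ratio G k)\<^sup>2" by (simp only: kdegree_ratio_eq real_sqrt_pow2)
      also have "\<dots> \<le> L\<^sup>2"
        using L(2)[of k] incseqD[OF incseq_kdegree_ratio[OF G ge1], of 0 k] ge1 by (intro power_mono) auto
      finally show ?thesis using pos[of k] by (simp add: divide_le_eq del: kdegree.simps)
    qed
    have up: "?s k \<le> (L\<^sup>2) ^ k * ?s 0" for k
    proof (induction k)
      case (Suc k)
      have "L\<^sup>2 * ?s k \<le> L\<^sup>2 * ((L\<^sup>2) ^ k * ?s 0)" by (rule mult_left_mono[OF Suc]) simp
      then show ?case using step[of k] by (simp only: power_Suc mult.assoc)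
    qed (simp del: kdegree.simps)
    obtain v where v: "v \<in> verts G" "\<And>k. \<rho> ^ k \<le> real (kdegree G k v)"
      using kdegree_ge_eigenvalue_power[OF G \<rho>(1)] \<rho>(2) by blast
    have low: "(\<rho>\<^sup>2) ^ k \<le> ?s k" for k
    proof -
      have "(\<rho>\<^sup>2) ^ k = (\<rho> ^ k)\<^sup>2" by (simp add: power_mult[symmetric] mult.commute)
      also have "\<dots> \<le> (real (kdegree G k v))\<^sup>2" using v(2)[of k] \<rho>0 by (intro power_mono) auto
      also have "\<dots> \<le> ?s k"
        using v(1) finite_verts[OF G] by (intro member_le_sum[where f = "\<lambda>i. (real (kdegree G k i))\<^sup>2"]) auto
      finally show ?thesis .
    qed
    have "1 < \<rho>\<^sup>2 / L\<^sup>2" using lt L1 by (simp add: power_strict_mono)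
    then obtain k where "?s 0 < (\<rho>\<^sup>2 / L\<^sup>2) ^ k" using real_arch_pow by blast
    then have "(L\<^sup>2) ^ k * ?s 0 < (\<rho>\<^sup>2) ^ k" using L1 by (simp add: power_divide field_simps)
    with up[of k] low[of k] show False by linarith
  qed
  ultimately show ?thesis using L(1) by simp
qed

lemma kdegree_regular:
  assumes "regular_graph r G" "v \<in> verts G"
  shows "kdegree G k v = r ^ k"
  using assms(2)
proof (induction k arbitrary: v)
  case (Suc k)
  have "(\<Sum>u\<in>neighbours G v. kdegree G k u) = (\<Sum>u\<in>neighbours G v. r ^ k)"
    by (intro sum.cong refl Suc.IH subsetD[OF neighbours_subset])
  then show ?case using assms(1) Suc.prems by (simp add: regular_graph_def)
qed simp

lemma kdegree_ratio_regular:
  assumes G: "simple_graph G" and r: "regular_graph r G" and ge1: "1 \<le> kdegree_ratio G 0"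
  shows "kdegree_ratio G k = real r"
proof -
  have s: "kdegree_sq_sum G k = real (card (verts G)) * (real r ^ k)\<^sup>2" for k
    by (simp add: kdegree_regular[OF r] del: kdegree.simps)
  \<comment> \<open>\<open>ge1\<close> excludes both an empty vertex set and \<open>r = 0\<close>,
    so the common factors cancel.\<close>
  have "0 < card (verts G)" "0 < r"
    using kdegree_sq_sum_pos[OF G ge1] unfolding s by (auto simp: zero_less_mult_iff)
  then have "kdegree_sq_sum G (Suc k) / kdegree_sq_sum G k = (real r)\<^sup>2"
    unfolding s by (simp add: power_mult_distrib)
  then show ?thesis unfolding kdegree_ratio_eq by simp
qed

section \<open>Cluster graphs, their spectra, and tests by quadratic forms\<close>

definition cluster_graph :: "'a ugraph \<Rightarrow> bool" where
  "cluster_graph G \<longleftrightarrow> (\<forall>u v w. adjacent G u v \<longrightarrow> adjacent G v w \<longrightarrow> u \<noteq> w \<longrightarrow> adjacent G u w)"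

text \<open>In a cluster graph, being equal or adjacent is an equivalence relation. The closed
  neighbourhoods are its classes, that is, the vertex sets of the complete components.\<close>

lemma cluster_closed_neighbours:
  assumes G: "simple_graph G" and "cluster_graph G" and "u \<in> insert v (neighbours G v)"
  shows "insert u (neighbours G u) = insert v (neighbours G v)"
proof (cases "u = v")
  case False
  then have vu: "adjacent G v u" using assms(3) by (simp add: neighbours_iff[OF G])
  then have "adjacent G u v" by (simp add: adjacent_sym)
  with vu have "w \<in> insert u (neighbours G u) \<longleftrightarrow> w \<in> insert v (neighbours G v)" for w
    using assms(2) unfolding cluster_graph_def neighbours_iff[OF G] insert_iff by metis
  then show ?thesis by blast
qed simp

lemma cluster_card_neighbours:
  assumes G: "simple_graph G" and "cluster_graph G" and "u \<in> insert v (neighbours G v)"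
  shows "card (neighbours G u) = card (neighbours G v)"
  using arg_cong[OF cluster_closed_neighbours[OF assms], of card]
  by (simp add: card_insert_disjoint finite_neighbours[OF G] self_notin_neighbours[OF G])

text \<open>On the clique of a vertex \<open>v\<close> with \<open>f v \<noteq> 0\<close>, every
  value satisfies \<open>(z + 1) * f u = S\<close>, where \<open>S\<close> is the sum of
  \<open>f\<close> over the clique. Summing over the clique gives \<open>z + 1\<close> as its size
  unless \<open>S = 0\<close>, and then \<open>z = -1\<close>.\<close>

lemma cluster_eigenvalue:
  assumes G: "simple_graph G" and cl: "cluster_graph G" and z: "eigenvalue (adj_matrix G) z"
  shows "z = -1 \<or> (\<exists>v\<in>verts G. z = of_nat (card (neighbours G v)))"
proof -
  obtain f v where f: "v \<in> verts G" "f v \<noteq> 0"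
      "\<And>v. v \<in> verts G \<Longrightarrow> (\<Sum>u\<in>neighbours G v. f u) = z * f v"
    using z unfolding eigenvalue_adj_matrix[OF G] by blast
  define S where "S = (\<Sum>u\<in>insert v (neighbours G v). f u)"
  have fS: "S = (z + 1) * f u" if u: "u \<in> insert v (neighbours G v)" for u
  proof -
    have "u \<in> verts G" using u f(1) neighbours_subset[of G v] by blast
    have "S = (\<Sum>w\<in>insert u (neighbours G u). f w)"
      unfolding S_def cluster_closed_neighbours[OF G cl u] ..
    also have "\<dots> = f u + z * f u"
      using f(3)[OF \<open>u \<in> verts G\<close>] by (simp add: finite_neighbours[OF G] self_notin_neighbours[OF G])
    finally show ?thesis by (simp add: algebra_simps)
  qed
  have "(z + 1) * S = (\<Sum>u\<in>insert v (neighbours G v). (z + 1) * f u)"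
    by (simp only: S_def sum_distrib_left)
  also have "\<dots> = (\<Sum>u\<in>insert v (neighbours G v). S)"
    by (intro sum.cong refl) (simp only: fS)
  also have "\<dots> = of_nat (Suc (card (neighbours G v))) * S"
    by (simp add: finite_neighbours[OF G] self_notin_neighbours[OF G] algebra_simps)
  finally have "z = of_nat (card (neighbours G v)) \<or> S = 0" by (auto simp: algebra_simps)
  moreover have "z = -1" if "S = 0"
    using fS[of v] f(2) that by (auto simp: add_eq_0_iff2)
  ultimately show ?thesis using f(1) by blast
qed

text \<open>The indicator function of the clique of \<open>v\<close> is an eigenfunction.\<close>

lemma cluster_degree_eigenvalue:
  assumes G: "simple_graph G" and cl: "cluster_graph G" and v: "v \<in> verts G"
  shows "eigenvalue (adj_matrix G) (of_nat (card (neighbours G v)))"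
proof -
  let ?C = "insert v (neighbours G v)"
  have "(\<Sum>u\<in>neighbours G w. of_bool (u \<in> ?C)) = of_nat (card (neighbours G v)) * (of_bool (w \<in> ?C) :: complex)"
    for w
  proof (cases "w \<in> ?C")
    case True
    have "neighbours G w \<subseteq> ?C" using cluster_closed_neighbours[OF G cl True] by blast
    then have "(\<Sum>u\<in>neighbours G w. of_bool (u \<in> ?C) :: complex) = (\<Sum>u\<in>neighbours G w. 1)"
      by (intro sum.cong) auto
    then show ?thesis using True cluster_card_neighbours[OF G cl True] by simp
  next
    case False
    have "u \<notin> ?C" if "u \<in> neighbours G w" for u
    proof
      assume u: "u \<in> ?C"
      have "w \<in> neighbours G u" using that by (simp add: neighbours_iff[OF G] adjacent_sym)
      then show False using cluster_closed_neighbours[OF G cl u] False by blast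
    qed
    then show ?thesis using False by simp
  qed
  then show ?thesis unfolding eigenvalue_adj_matrix[OF G]
    using v by (intro exI[of _ "\<lambda>u. of_bool (u \<in> ?C)"]) auto
qed

text \<open>The test function has values 1, \<open>c\<close>, 1 along a path with middle vertex
  \<open>v\<close>. Each path edge contributes \<open>2 * c\<close>, and an edge joining the ends
  contributes 2. The values -1 and 1 of \<open>c\<close> serve the lower and the upper spectral
  bound.\<close>

lemma path3_quadratic_form:
  fixes c :: real
  assumes G: "simple_graph G" and "adjacent G u v" "adjacent G v w" "u \<noteq> w"
  defines "x \<equiv> \<lambda>t. if t = v then c else if t = u \<or> t = w then 1 else 0"
  shows "(\<Sum>t\<in>verts G. (x t)\<^sup>2) = c\<^sup>2 + 2"
    and "(\<Sum>t\<in>verts G. x t * kernel_op (verts G) (adj_kernel G) x t)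
      = 4 * c + 2 * of_bool (adjacent G u w)"
proof -
  note fin = finite_verts[OF G]
  have d: "u \<noteq> v" "v \<noteq> w" using adjacentD(3)[OF G] assms by auto
  have sub: "{u, v, w} \<subseteq> verts G" using adjacentD[OF G] assms by blast
  have three: "(\<Sum>t\<in>verts G. x t * g t) = c * g v + g u + g w" for g
  proof -
    have "(\<Sum>t\<in>verts G. x t * g t) = (\<Sum>t\<in>{u, v, w}. x t * g t)"
      by (rule sum.mono_neutral_right[OF fin sub]) (auto simp: x_def)
    then show ?thesis using d assms(4) by (simp add: x_def)
  qed
  have "(\<Sum>t\<in>verts G. (x t)\<^sup>2) = (\<Sum>t\<in>verts G. x t * x t)" by (simp add: power2_eq_square)
  also have "\<dots> = c\<^sup>2 + 2" unfolding three using d by (simp add: x_def power2_eq_square)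
  finally show "(\<Sum>t\<in>verts G. (x t)\<^sup>2) = c\<^sup>2 + 2" .
  have op: "kernel_op (verts G) (adj_kernel G) x t
    = c * adj_kernel G t v + adj_kernel G t u + adj_kernel G t w" for t
    unfolding kernel_op_def using three[of "adj_kernel G t"] by (simp add: mult.commute)
  have na: "\<not> adjacent G t t" for t using adjacentD(3)[OF G] by blast
  show "(\<Sum>t\<in>verts G. x t * kernel_op (verts G) (adj_kernel G) x t)
      = 4 * c + 2 * of_bool (adjacent G u w)"
    unfolding three op using assms(2,3) adjacent_sym[of G] by (simp add: na)
qed

text \<open>On an induced path the test function with \<open>c = -1\<close> has squared norm 3 and
  form -4, below what the least eigenvalue permits.\<close>

lemma cluster_graph_if_eigenvalues_ge:
  assumes G: "simple_graph G" and ev: "\<And>z. eigenvalue (adj_matrix G) z \<Longrightarrow> - 1 \<le> Re z"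
  shows "cluster_graph G"
  unfolding cluster_graph_def
proof (intro allI impI, rule ccontr)
  fix u v w assume a: "adjacent G u v" "adjacent G v w" "u \<noteq> w" "\<not> adjacent G u w"
  define x :: "'a \<Rightarrow> real" where "x = (\<lambda>t. if t = v then - 1 else if t = u \<or> t = w then 1 else 0)"
  have "- 1 * (\<Sum>t\<in>verts G. (x t)\<^sup>2) \<le> (\<Sum>t\<in>verts G. x t * kernel_op (verts G) (adj_kernel G) x t)"
    by (rule kernel_quadratic_form_ge[OF finite_verts[OF G]])
      (use ev adjacent_sym[of G] in \<open>auto simp: adj_matrix_kernel\<close>)
  moreover have "(\<Sum>t\<in>verts G. (x t)\<^sup>2) = (- 1)\<^sup>2 + 2"
    and "(\<Sum>t\<in>verts G. x t * kernel_op (verts G) (adj_kernel G) x t)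
      = 4 * (- 1) + 2 * adj_kernel G u w"
    unfolding x_def by (fact path3_quadratic_form[OF G a(1-3)])+
  ultimately show False using a(4) by simp
qed

text \<open>Two neighbours of \<open>v\<close> give a path. For \<open>c = 1\<close> the form is at
  least 4 while the squared norm is 3.\<close>

lemma card_neighbours_le_1_if_eigenvalues_le:
  assumes G: "simple_graph G" and ev: "\<And>z. eigenvalue (adj_matrix G) z \<Longrightarrow> Re z \<le> 1"
  shows "card (neighbours G v) \<le> 1"
proof (rule ccontr)
  assume "\<not> ?thesis"
  then obtain u w where "u \<in> neighbours G v" "w \<in> neighbours G v" "u \<noteq> w"
    using finite_neighbours[OF G] card_le_Suc0_iff_eq[of "neighbours G v"] by auto
  then have a: "adjacent G u v" "adjacent G v w" "u \<noteq> w"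
    using adjacent_sym[of G] by (auto simp: neighbours_iff[OF G])
  define x :: "'a \<Rightarrow> real" where "x = (\<lambda>t. if t = v then 1 else if t = u \<or> t = w then 1 else 0)"
  have "(\<Sum>t\<in>verts G. x t * kernel_op (verts G) (adj_kernel G) x t) \<le> 1 * (\<Sum>t\<in>verts G. (x t)\<^sup>2)"
    by (rule kernel_quadratic_form_le[OF finite_verts[OF G]])
      (use ev adjacent_sym[of G] in \<open>auto simp: adj_matrix_kernel\<close>)
  moreover have "0 \<le> adj_kernel G u w" by simp
  moreover have "(\<Sum>t\<in>verts G. (x t)\<^sup>2) = 1\<^sup>2 + 2"
    and "(\<Sum>t\<in>verts G. x t * kernel_op (verts G) (adj_kernel G) x t)
      = 4 * 1 + 2 * adj_kernel G u w"
    unfolding x_def by (fact path3_quadratic_form[OF G a])+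
  ultimately show False by simp
qed

section \<open>Cluster graphs and isomorphisms\<close>

lemma component_simple_graph:
  assumes "simple_graph G" "connected_component_of H G"
  shows "simple_graph H"
proof -
  have "verts H \<subseteq> verts G" "edges H = {e \<in> edges G. e \<subseteq> verts H}"
    using assms(2) by (auto simp: connected_component_of_def)
  then show ?thesis using assms(1) finite_subset by (auto simp: simple_graph_def)
qed

text \<open>A component of a cluster graph is a single closed neighbourhood. Regularity makes its
  degree ratios constant, which settles the converse direction of the equality case.\<close>

lemma cluster_component_regular:
  assumes G: "simple_graph G" and cl: "cluster_graph G" and H: "connected_component_of H G"
  shows "\<exists>r. regular_graph r H"
proof -
  obtain v where v: "v \<in> verts G" "verts H = {u \<in> verts G. (adjacent G)\<^sup>*\<^sup>* v u}"
      "edges H = {e \<in> edges G. e \<subseteq> verts H}"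
    using H by (auto simp: connected_component_of_def)
  \<comment> \<open>Transitivity collapses every path to at most one edge.\<close>
  have reach: "u = v \<or> adjacent G v u" if "(adjacent G)\<^sup>*\<^sup>* v u" for u
    using that
  proof induction
    case (step y z)
    then show ?case using cl unfolding cluster_graph_def by metis
  qed simp
  have vH: "verts H = insert v (neighbours G v)"
  proof
    show "verts H \<subseteq> insert v (neighbours G v)"
      unfolding v(2) using reach neighbours_iff[OF G] by blast
    show "insert v (neighbours G v) \<subseteq> verts H"
      unfolding v(2) using v(1) neighbours_subset[of G v] neighbours_iff[OF G] by blast
  qed
  have "neighbours H u = neighbours G u" if u: "u \<in> verts H" for u
  proof -
    have "neighbours G u \<subseteq> verts H"
      using cluster_closed_neighbours[OF G cl, of u v] u vH by auto
    moreover have "neighbours H u = {w \<in> verts H. adjacent G u w}"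
      using u v(3) by (auto simp: neighbours_def adjacent_def)
    ultimately show ?thesis using neighbours_iff[OF G, of _ u] by auto
  qed
  moreover have "card (neighbours G u) = card (neighbours G v)" if "u \<in> verts H" for u
    using cluster_card_neighbours[OF G cl] that vH by simp
  ultimately show ?thesis unfolding regular_graph_def by auto
qed

section \<open>Adjacency and degrees in complete graphs, disjoint unions and copies\<close>

lemma adjacent_complete_graph: "adjacent (complete_graph s) a b \<longleftrightarrow> a \<noteq> b \<and> a < s \<and> b < s"
  by (auto simp: adjacent_def complete_graph_def card_insert_if)

lemma verts_complete_graph: "verts (complete_graph s) = {..<s}"
  by (simp add: complete_graph_def)

lemma adjacent_disjoint_union:
  "adjacent (disjoint_union H K) (Inl a) (Inl b) \<longleftrightarrow> adjacent H a b"
  "adjacent (disjoint_union H K) (Inr c) (Inr d) \<longleftrightarrow> adjacent K c d"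
  "\<not> adjacent (disjoint_union H K) (Inl a) (Inr d)"
  "\<not> adjacent (disjoint_union H K) (Inr c) (Inl b)"
proof -
  have inj: "inj ((`) f)" if "inj f" for f :: "'c \<Rightarrow> 'd"
    using that by (intro injI) (simp add: inj_image_eq_iff)
  have l: "{Inl a, Inl b} = Inl ` {a, b}" and r: "{Inr c, Inr d} = Inr ` {c, d}" by auto
  have "Inl ` {a, b} \<notin> (`) Inr ` edges K" "Inr ` {c, d} \<notin> (`) Inl ` edges H" by auto
  then show "adjacent (disjoint_union H K) (Inl a) (Inl b) \<longleftrightarrow> adjacent H a b"
    and "adjacent (disjoint_union H K) (Inr c) (Inr d) \<longleftrightarrow> adjacent K c d"
    unfolding adjacent_def disjoint_union_def snd_conv l r Un_iff
    by (simp_all only: inj_image_mem_iff[OF inj] inj_Inl inj_Inr simp_thms)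
  have "Inl a \<in> {Inl a, Inr d}" "Inr d \<in> {Inl a, Inr d}"
    and "Inr c \<in> {Inr c, Inl b}" "Inl b \<in> {Inr c, Inl b}" by simp_all
  then show "\<not> adjacent (disjoint_union H K) (Inl a) (Inr d)"
    and "\<not> adjacent (disjoint_union H K) (Inr c) (Inl b)"
    unfolding adjacent_def disjoint_union_def snd_conv Un_iff by (metis imageE sum.distinct(1))+
qed

lemma verts_disjoint_union: "verts (disjoint_union H K) = verts H <+> verts K"
  by (simp add: disjoint_union_def)

lemma adjacent_copies:
  "adjacent (copies t H) (i, a) (j, b) \<longleftrightarrow> i = j \<and> i < t \<and> adjacent H a b"
proof -
  have inj: "inj (Pair k)" for k :: nat by (rule injI) simp
  have "{(i, a), (j, b)} = Pair k ` e \<longleftrightarrow> i = k \<and> j = k \<and> e = {a, b}" for k e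
  proof
    assume eq: "{(i, a), (j, b)} = Pair k ` e"
    then have "(i, a) \<in> Pair k ` e" "(j, b) \<in> Pair k ` e" by auto
    then have "i = k" "j = k" by auto
    moreover have "Pair k ` {a, b} = Pair k ` e" using eq \<open>i = k\<close> \<open>j = k\<close> by simp
    ultimately show "i = k \<and> j = k \<and> e = {a, b}" by (metis inj inj_image_eq_iff)
  qed auto
  then show ?thesis by (auto simp: adjacent_def copies_def image_iff)
qed

lemma verts_copies: "verts (copies t H) = {..<t} \<times> verts H"
  by (simp add: copies_def)

lemma cluster_graphD:
  "cluster_graph G \<Longrightarrow> adjacent G u v \<Longrightarrow> adjacent G v w \<Longrightarrow> u \<noteq> w \<Longrightarrow> adjacent G u w"
  unfolding cluster_graph_def by blast

lemma cluster_complete_graph: "cluster_graph (complete_graph s)"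
  by (auto simp: cluster_graph_def adjacent_complete_graph)

lemma cluster_disjoint_union:
  assumes "cluster_graph H" "cluster_graph K"
  shows "cluster_graph (disjoint_union H K)"
  unfolding cluster_graph_def
proof (intro allI impI)
  fix u v w assume "adjacent (disjoint_union H K) u v" "adjacent (disjoint_union H K) v w" "u \<noteq> w"
  then show "adjacent (disjoint_union H K) u w"
    by (cases u; cases v; cases w)
      (simp_all add: adjacent_disjoint_union,
       (blast intro: cluster_graphD[OF assms(1)] cluster_graphD[OF assms(2)])+)
qed

lemma cluster_copies:
  assumes "cluster_graph H"
  shows "cluster_graph (copies t H)"
  unfolding cluster_graph_def
proof (intro allI impI)
  fix u v w assume "adjacent (copies t H) u v" "adjacent (copies t H) v w" "u \<noteq> w"
  then show "adjacent (copies t H) u w"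
    by (cases u; cases v; cases w) (simp add: adjacent_copies, blast intro: cluster_graphD[OF assms])
qed

lemma card_neighbours_complete_graph:
  assumes "a \<in> verts (complete_graph s)"
  shows "card (neighbours (complete_graph s) a) = s - 1"
proof -
  have "neighbours (complete_graph s) a = {..<s} - {a}"
    using assms by (auto simp: neighbours_def adjacent_complete_graph verts_complete_graph)
  then show ?thesis using assms by (simp add: verts_complete_graph)
qed

lemma card_neighbours_disjoint_union:
  "card (neighbours (disjoint_union H K) (Inl a)) = card (neighbours H a)"
  "card (neighbours (disjoint_union H K) (Inr b)) = card (neighbours K b)"
proof -
  have "neighbours (disjoint_union H K) (Inl a) = Inl ` neighbours H a"
    and "neighbours (disjoint_union H K) (Inr b) = Inr ` neighbours K b"
    by (auto simp: neighbours_def adjacent_disjoint_union verts_disjoint_union)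
  then show "card (neighbours (disjoint_union H K) (Inl a)) = card (neighbours H a)"
    and "card (neighbours (disjoint_union H K) (Inr b)) = card (neighbours K b)"
    by (simp_all add: card_image)
qed

lemma card_neighbours_copies:
  assumes "i < t"
  shows "card (neighbours (copies t H) (i, a)) = card (neighbours H a)"
proof -
  have "neighbours (copies t H) (i, a) = Pair i ` neighbours H a"
    using assms by (auto simp: neighbours_def adjacent_copies verts_copies)
  then show ?thesis by (simp add: card_image inj_on_def)
qed

section \<open>Transport of the cluster property and of degrees along isomorphisms\<close>

lemma graph_iso_cluster:
  assumes G: "simple_graph G" and iso: "graph_iso G H" and "cluster_graph H"
  shows "cluster_graph G"
proof -
  obtain f where f: "bij_betw f (verts G) (verts H)"
      "\<And>u v. u \<in> verts G \<Longrightarrow> v \<in> verts G \<Longrightarrow> adjacent G u v \<longleftrightarrow> adjacent H (f u) (f v)"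
    using iso by (auto simp: graph_iso_def)
  show ?thesis unfolding cluster_graph_def
  proof (intro allI impI)
    fix u v w assume a: "adjacent G u v" "adjacent G v w" "u \<noteq> w"
    then have V: "u \<in> verts G" "v \<in> verts G" "w \<in> verts G" using adjacentD[OF G] by blast+
    then have "f u \<noteq> f w" using a(3) f(1) by (auto simp: bij_betw_def inj_on_def)
    then show "adjacent G u w" using a V f(2) assms(3) unfolding cluster_graph_def by metis
  qed
qed

lemma graph_iso_card_neighbours:
  assumes "graph_iso G H"
  obtains f where "bij_betw f (verts G) (verts H)"
    "\<And>v. v \<in> verts G \<Longrightarrow> card (neighbours G v) = card (neighbours H (f v))"
proof -
  obtain f where f: "bij_betw f (verts G) (verts H)"
      "\<And>u v. u \<in> verts G \<Longrightarrow> v \<in> verts G \<Longrightarrow> adjacent G u v \<longleftrightarrow> adjacent H (f u) (f v)"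
    using assms by (auto simp: graph_iso_def)
  have "card (neighbours G v) = card (neighbours H (f v))" if "v \<in> verts G" for v
  proof -
    have "neighbours H (f v) = {w \<in> f ` verts G. adjacent H (f v) w}"
      using f(1) by (simp add: neighbours_def bij_betw_def)
    also have "\<dots> = f ` neighbours G v" using that f(2) by (auto simp: neighbours_def)
    finally have "neighbours H (f v) = f ` neighbours G v" .
    moreover have "inj_on f (neighbours G v)"
      using f(1) neighbours_subset[of G v] by (auto simp: bij_betw_def intro: inj_on_subset)
    ultimately show ?thesis by (simp add: card_image)
  qed
  with f(1) that show thesis by blast
qed

section \<open>Assembling isomorphisms from induced subgraphs\<close>

definition induced :: "'a set \<Rightarrow> 'a ugraph \<Rightarrow> 'a ugraph" where
  "induced X G = (X, {e \<in> edges G. e \<subseteq> X})"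

lemma verts_induced [simp]: "verts (induced X G) = X"
  by (simp add: induced_def)

lemma adjacent_induced [simp]:
  "u \<in> X \<Longrightarrow> v \<in> X \<Longrightarrow> adjacent (induced X G) u v \<longleftrightarrow> adjacent G u v"
  by (simp add: adjacent_def induced_def)

lemma induced_verts: "simple_graph G \<Longrightarrow> induced (verts G) G = G"
  by (auto simp: induced_def simple_graph_def prod_eq_iff)

lemma graph_iso_induced_Un:
  assumes "graph_iso (induced X G) H" "graph_iso (induced Y G) K" "X \<inter> Y = {}"
    and no_edge: "\<And>u v. u \<in> X \<Longrightarrow> v \<in> Y \<Longrightarrow> \<not> adjacent G u v"
  shows "graph_iso (induced (X \<union> Y) G) (disjoint_union H K)"
proof -
  obtain f where f: "bij_betw f X (verts H)"
      "\<And>u v. u \<in> X \<Longrightarrow> v \<in> X \<Longrightarrow> adjacent G u v \<longleftrightarrow> adjacent H (f u) (f v)"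
    using assms(1) by (auto simp: graph_iso_def)
  obtain g where g: "bij_betw g Y (verts K)"
      "\<And>u v. u \<in> Y \<Longrightarrow> v \<in> Y \<Longrightarrow> adjacent G u v \<longleftrightarrow> adjacent K (g u) (g v)"
    using assms(2) by (auto simp: graph_iso_def)
  have no_edge': "\<not> adjacent G v u" if "u \<in> X" "v \<in> Y" for u v
    using no_edge[OF that] by (simp add: adjacent_sym)
  define k where "k v = (if v \<in> X then Inl (f v) else Inr (g v))" for v
  have kX: "k v = Inl (f v)" if "v \<in> X" for v using that by (simp add: k_def)
  have kY: "k v = Inr (g v)" if "v \<in> Y" for v using that assms(3) by (auto simp: k_def)
  have "bij_betw k X (Inl ` verts H)"
    using f(1) unfolding bij_betw_def inj_on_def by (auto simp: kX image_iff)
  moreover have "bij_betw k Y (Inr ` verts K)"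
    using g(1) unfolding bij_betw_def inj_on_def by (auto simp: kY image_iff)
  ultimately have "bij_betw k (X \<union> Y) (Inl ` verts H \<union> Inr ` verts K)"
    by (rule bij_betw_combine) auto
  then have "bij_betw k (X \<union> Y) (verts (disjoint_union H K))"
    by (simp add: verts_disjoint_union Plus_def)
  moreover have "adjacent G u v \<longleftrightarrow> adjacent (disjoint_union H K) (k u) (k v)"
    if "u \<in> X \<union> Y" "v \<in> X \<union> Y" for u v
    using that f(2) g(2) no_edge no_edge'
    by (auto simp: kX kY adjacent_disjoint_union)
  ultimately show ?thesis unfolding graph_iso_def by (auto intro!: exI[of _ k])
qed

lemma graph_iso_induced_clique:
  assumes "finite X" and clique: "\<And>u v. u \<in> X \<Longrightarrow> v \<in> X \<Longrightarrow> adjacent G u v \<longleftrightarrow> u \<noteq> v"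
  shows "graph_iso (induced X G) (complete_graph (card X))"
proof -
  obtain f where f: "bij_betw f X {0..<card X}"
    using ex_bij_betw_finite_nat[OF assms(1)] by blast
  have "adjacent G u v \<longleftrightarrow> adjacent (complete_graph (card X)) (f u) (f v)"
    if "u \<in> X" "v \<in> X" for u v
    using f that clique by (auto simp: adjacent_complete_graph bij_betw_def inj_on_def)
  then show ?thesis using f unfolding graph_iso_def
    by (auto intro!: exI[of _ f] simp: verts_complete_graph atLeast0LessThan)
qed

text \<open>The closed neighbourhoods partition \<open>X\<close> into cliques of size
  \<open>s\<close>. A vertex is sent to the number of its clique, given by \<open>g\<close>, paired
  with its number inside the clique, given by \<open>h\<close>.\<close>

lemma graph_iso_induced_copies:
  assumes G: "simple_graph G" and cl: "cluster_graph G" and X: "X \<subseteq> verts G"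
    and closed: "\<And>v. v \<in> X \<Longrightarrow> neighbours G v \<subseteq> X"
    and deg: "\<And>v. v \<in> X \<Longrightarrow> Suc (card (neighbours G v)) = s"
  obtains t where "card X = t * s" "graph_iso (induced X G) (copies t (complete_graph s))"
proof -
  define C where "C v = insert v (neighbours G v)" for v
  have finX: "finite X" using X finite_verts[OF G] by (rule finite_subset)
  have C_eq: "C u = C v" if "u \<in> C v" for u v
    using cluster_closed_neighbours[OF G cl] that by (simp add: C_def)
  have C_self: "v \<in> C v" for v by (simp add: C_def)
  have finC: "finite (C v)" for v by (simp add: C_def finite_neighbours[OF G])
  have cardC: "card (C v) = s" if "v \<in> X" for v
    using deg[OF that] by (simp add: C_def finite_neighbours[OF G] self_notin_neighbours[OF G])
  have CX: "C v \<subseteq> X" if "v \<in> X" for v using closed that by (auto simp: C_def)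
  have adj: "adjacent G u v \<longleftrightarrow> u \<noteq> v \<and> C u = C v" for u v
  proof
    assume "adjacent G u v"
    then show "u \<noteq> v \<and> C u = C v"
      using C_eq[of v u] adjacentD(3)[OF G] by (auto simp: C_def neighbours_iff[OF G])
  next
    assume "u \<noteq> v \<and> C u = C v"
    then have "v \<in> neighbours G u" using C_self[of v] by (auto simp: C_def)
    then show "adjacent G u v" by (simp add: neighbours_iff[OF G])
  qed
  define t where "t = card (C ` X)"
  obtain g where g: "bij_betw g (C ` X) {0..<t}"
    using ex_bij_betw_finite_nat[of "C ` X"] finX by (auto simp: t_def)
  \<comment> \<open>The inner numbering is chosen per clique and not per vertex, so all members of a
    clique share it.\<close>
  have "\<exists>h. bij_betw h c {0..<card c}" if "c \<in> C ` X" for c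
    using that finC ex_bij_betw_finite_nat by blast
  then obtain h where h: "\<And>c. c \<in> C ` X \<Longrightarrow> bij_betw (h c) c {0..<card c}" by metis
  have hC: "bij_betw (h (C v)) (C v) {..<s}" if "v \<in> X" for v
    using h[of "C v"] cardC[OF that] that by (simp add: atLeast0LessThan)
  define f where "f v = (g (C v), h (C v) v)" for v
  have inj: "inj_on f X"
  proof (rule inj_onI)
    fix u v assume uv: "u \<in> X" "v \<in> X" "f u = f v"
    then have "C u = C v" using g by (auto simp: f_def bij_betw_def inj_on_def)
    then have "u \<in> C v" "h (C v) u = h (C v) v" using uv C_self[of u] by (auto simp: f_def)
    then show "u = v" using hC[OF uv(2)] C_self[of v] by (auto simp: bij_betw_def inj_on_def)
  qed
  have img: "f ` X = {..<t} \<times> {..<s}"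
  proof
    show "f ` X \<subseteq> {..<t} \<times> {..<s}"
      using g hC C_self by (fastforce simp: f_def bij_betw_def)
    show "{..<t} \<times> {..<s} \<subseteq> f ` X"
    proof
      fix p assume "p \<in> {..<t} \<times> {..<s}"
      then obtain i j where p: "p = (i, j)" "i < t" "j < s" by blast
      obtain v where v: "v \<in> X" "i = g (C v)" using g p(2) by (fastforce simp: bij_betw_def)
      obtain u where u: "u \<in> C v" "j = h (C v) u" using hC[OF v(1)] p(3)
        by (metis bij_betw_imp_surj_on imageE lessThan_iff)
      have "f u = p" using C_eq[OF u(1)] u v p by (simp add: f_def)
      then show "p \<in> f ` X" using u(1) CX[OF v(1)] by blast
    qed
  qed
  have bij: "bij_betw f X (verts (copies t (complete_graph s)))"
    using inj img by (simp add: bij_betw_def verts_copies verts_complete_graph)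
  have "adjacent G u v \<longleftrightarrow> adjacent (copies t (complete_graph s)) (f u) (f v)"
    if uv: "u \<in> X" "v \<in> X" for u v
  proof -
    have g_eq: "g (C u) = g (C v) \<longleftrightarrow> C u = C v"
      using g uv by (auto simp: bij_betw_def inj_on_def)
    have fs: "g (C u) < t" "h (C u) u < s" "h (C v) v < s"
      using img uv by (auto simp: f_def image_subset_iff set_eq_iff)
    have "f u = f v \<longleftrightarrow> u = v" using inj uv by (auto simp: inj_on_def)
    then show ?thesis unfolding adj using g_eq fs
      by (auto simp: f_def adjacent_copies adjacent_complete_graph)
  qed
  with bij have "graph_iso (induced X G) (copies t (complete_graph s))"
    unfolding graph_iso_def by (auto intro!: exI[of _ f])
  moreover have "card X = t * s"
    using bij_betw_same_card[OF bij] by (simp add: verts_copies verts_complete_graph card_cartesian_product)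
  ultimately show thesis using that by blast
qed

section \<open>The extremal graphs\<close>

lemma set_adj_eigenvalue_list:
  "z \<in> set (eigenvalue_list (adj_matrix G)) \<longleftrightarrow> eigenvalue (adj_matrix G) z"
  by (simp add: set_eigenvalue_list[OF adj_matrix_carrier] spectrum_def)

lemma length_adj_eigenvalue_list: "length (eigenvalue_list (adj_matrix G)) = card (verts G)"
  by (rule eigenvalue_list(2)[OF adj_matrix_carrier])

lemma largest_eigenvalue:
  assumes G: "simple_graph G" and "verts G \<noteq> {}"
  shows "eigenvalue (adj_matrix G) (of_real (largest_eigenvalue G))"
    and "eigenvalue (adj_matrix G) z \<Longrightarrow> Re z \<le> largest_eigenvalue G"
proof -
  let ?S = "spectrum (adj_matrix G)"
  have "0 < card (verts G)" using assms finite_verts[OF G] by (simp add: card_gt_0_iff)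
  then have ne: "?S \<noteq> {}" by (rule spectrum_non_empty[OF adj_matrix_carrier])
  have fin: "finite ?S" by (rule card_finite_spectrum[OF adj_matrix_carrier])
  have "largest_eigenvalue G \<in> Re ` ?S"
    unfolding largest_eigenvalue_def using ne fin by (intro Max_in) auto
  then obtain w where w: "eigenvalue (adj_matrix G) w" "largest_eigenvalue G = Re w"
    by (auto simp: spectrum_def)
  then show "eigenvalue (adj_matrix G) (of_real (largest_eigenvalue G))"
    using adj_eigenvalue_real[OF G w(1)] by simp
  show "Re z \<le> largest_eigenvalue G" if "eigenvalue (adj_matrix G) z"
    unfolding largest_eigenvalue_def using that fin by (intro Max_ge) (auto simp: spectrum_def)
qed

lemma adj_eigenvalue_unit:
  assumes "simple_graph G" "eigenvalue (adj_matrix G) z" "cmod z = 1"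
  shows "z = 1 \<or> z = -1"
proof -
  have z: "z = of_real (Re z)" by (rule adj_eigenvalue_real[OF assms(1,2)])
  then have "\<bar>Re z\<bar> = 1" using assms(3) by (metis norm_of_real)
  then have "Re z = 1 \<or> Re z = -1" by linarith
  then show ?thesis using z by (metis of_real_1 of_real_minus)
qed

text \<open>For these values \<open>z ^ 2\<close> counts the nonzero entries and
  \<open>z ^ 3\<close> equals \<open>z\<close>, so second and third traces reduce to the nullity and
  the first trace.\<close>

lemma sum_list_power_unit:
  fixes L :: "complex list"
  assumes "\<And>z. z \<in> set L \<Longrightarrow> z = 0 \<or> z = 1 \<or> z = -1"
  shows "(\<Sum>z\<leftarrow>L. z ^ 2) = of_nat (length (filter (\<lambda>z. z \<noteq> 0) L))"
    and "(\<Sum>z\<leftarrow>L. z ^ 3) = (\<Sum>z\<leftarrow>L. z)"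
proof -
  have "\<forall>z\<in>set L. z = 0 \<or> z = 1 \<or> z = -1" using assms by blast
  then show "(\<Sum>z\<leftarrow>L. z ^ 2) = of_nat (length (filter (\<lambda>z. z \<noteq> 0) L))"
    and "(\<Sum>z\<leftarrow>L. z ^ 3) = (\<Sum>z\<leftarrow>L. z)"
    by (induction L) auto
qed

lemma energy_ge:
  fixes \<rho> :: real
  assumes "eigenvalue (adj_matrix G) (of_real \<rho>)" "0 < \<rho>"
  defines "bound \<equiv> \<rho> + real (card (verts G)) - real (nullity G) - 1
    + ln (cmod (Upsilon (card (verts G) - nullity G) (adj_matrix G))) - ln \<rho>"
  shows "energy G \<ge> bound"
    and "energy G = bound \<longleftrightarrow>
      (\<forall>z\<in>set (remove1 (of_real \<rho>) (eigenvalue_list (adj_matrix G))). z = 0 \<or> cmod z = 1)"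
proof -
  let ?L = "eigenvalue_list (adj_matrix G)"
  have "of_real \<rho> \<in> set ?L" using assms(1) by (simp add: set_adj_eigenvalue_list)
  note * = sum_norm_ge_ln_remove1[OF assms(2) this]
  have b: "bound = \<rho> + (real (length ?L) - real (count_list ?L 0)) - 1
      + ln (\<Prod>z\<leftarrow>filter (\<lambda>z. z \<noteq> 0) ?L. cmod z) - ln \<rho>"
    using norm_Upsilon_nonzero[OF adj_matrix_carrier[of G]]
    by (simp add: bound_def nullity_def length_adj_eigenvalue_list)
  show "energy G \<ge> bound" unfolding b energy_def by (rule *(1))
  show "energy G = bound \<longleftrightarrow> (\<forall>z\<in>set (remove1 (of_real \<rho>) ?L). z = 0 \<or> cmod z = 1)"
    unfolding b energy_def by (rule *(2))
qed

text \<open>The ends of an edge share one closed neighbourhood, and their common neighbours are the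
  rest of it. This evaluates the count in \<open>adj_trace3\<close>.\<close>

lemma cluster_common_neighbours:
  assumes G: "simple_graph G" and cl: "cluster_graph G" and "u \<in> neighbours G v"
  shows "card (neighbours G v \<inter> neighbours G u) = card (neighbours G v) - 1"
proof -
  have "insert u (neighbours G u) = insert v (neighbours G v)"
    using cluster_closed_neighbours[OF G cl] assms(3) by simp
  then have "neighbours G v \<inter> neighbours G u = neighbours G v - {u}"
    using self_notin_neighbours[OF G, of u] self_notin_neighbours[OF G, of v] by blast
  then show ?thesis using assms(3) by simp
qed

text \<open>Degrees are constant on cliques, so no edge leaves a degree class and the graph splits
  along them. The value \<open>r = 1\<close> is allowed, so that the lemma also covers
  matchings.\<close>

lemma cluster_degree_classes:
  assumes G: "simple_graph G" and cl: "cluster_graph G"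
    and deg: "\<forall>v\<in>verts G. card (neighbours G v) \<in> {0, 1, r}"
  defines "D \<equiv> \<lambda>d. {v \<in> verts G. card (neighbours G v) = d}"
  shows "verts G = (D r \<union> D 0) \<union> D 1"
    and "\<And>d v. v \<in> D d \<Longrightarrow> neighbours G v \<subseteq> D d"
    and "\<And>d e u v. d \<noteq> e \<Longrightarrow> u \<in> D d \<Longrightarrow> v \<in> D e \<Longrightarrow> \<not> adjacent G u v"
proof -
  show "verts G = (D r \<union> D 0) \<union> D 1"
  proof (intro equalityI subsetI)
    fix v assume "v \<in> verts G"
    then show "v \<in> (D r \<union> D 0) \<union> D 1" using bspec[OF deg, of v] by (simp add: D_def) blast
  qed (auto simp: D_def)
  show closed: "neighbours G v \<subseteq> D d" if "v \<in> D d" for d v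
  proof
    fix u assume u: "u \<in> neighbours G v"
    then have "card (neighbours G u) = card (neighbours G v)"
      by (intro cluster_card_neighbours[OF G cl]) simp
    then show "u \<in> D d" using that subsetD[OF neighbours_subset u] by (simp add: D_def)
  qed
  show "\<not> adjacent G u v" if "d \<noteq> e" "u \<in> D d" "v \<in> D e" for d e u v
    using closed[OF that(2)] that(1,3) by (auto simp: D_def neighbours_iff[OF G])
qed

text \<open>With degrees at most 1 no two distinct edges share a vertex, so the cluster property
  holds vacuously. The degree classes then give the copies of the two complete graphs.\<close>

lemma matching_graph_iso:
  assumes G: "simple_graph G" and deg: "\<And>v. v \<in> verts G \<Longrightarrow> card (neighbours G v) \<le> 1"
  defines "D \<equiv> \<lambda>d. {v \<in> verts G. card (neighbours G v) = d}"
  shows "cluster_graph G"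
    and "graph_iso G (disjoint_union (copies (card (D 1) div 2) (complete_graph 2))
                                     (copies (card (D 0)) (complete_graph 1)))"
    and "card (verts G) = card (D 1) + card (D 0)"
proof -
  have D: "D d = {v \<in> verts G. card (neighbours G v) = d}" for d by (simp add: D_def)
  show cl: "cluster_graph G"
    unfolding cluster_graph_def
  proof (intro allI impI)
    fix u v w assume a: "adjacent G u v" "adjacent G v w" "u \<noteq> w"
    have "adjacent G v u" using a(1) by (simp add: adjacent_sym)
    then have "u \<in> neighbours G v" "w \<in> neighbours G v" using a(2) by (simp_all add: neighbours_iff[OF G])
    moreover have "card (neighbours G v) \<le> Suc 0" using deg[OF adjacentD(2)[OF G a(1)]] by simp
    ultimately have "u = w" by (simp only: card_le_Suc0_iff_eq[OF finite_neighbours[OF G]])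
    then show "adjacent G u w" using a(3) by simp
  qed
  have "\<forall>v\<in>verts G. card (neighbours G v) \<in> {0, 1, 1}" using deg by (simp add: le_Suc_eq)
  note classes = cluster_degree_classes[OF G cl this, folded D]
  have V: "D 1 \<union> D 0 = verts G" by (subst classes(1)) blast
  have DV: "D d \<subseteq> verts G" for d by (auto simp: D_def)
  obtain t where t: "card (D 1) = t * 2" "graph_iso (induced (D 1) G) (copies t (complete_graph 2))"
    by (rule graph_iso_induced_copies[OF G cl DV classes(2), of 1 2]) (auto simp: D_def)
  obtain s where s: "card (D 0) = s * 1" "graph_iso (induced (D 0) G) (copies s (complete_graph 1))"
    by (rule graph_iso_induced_copies[OF G cl DV classes(2), of 0 1]) (auto simp: D_def)
  have disj: "D 1 \<inter> D 0 = {}" by (auto simp: D_def)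
  have "graph_iso (induced (D 1 \<union> D 0) G)
      (disjoint_union (copies t (complete_graph 2)) (copies s (complete_graph 1)))"
    by (rule graph_iso_induced_Un[OF t(2) s(2) disj classes(3)[of 1 0]]) simp
  then show "graph_iso G (disjoint_union (copies (card (D 1) div 2) (complete_graph 2))
                                     (copies (card (D 0)) (complete_graph 1)))"
    using t(1) s(1) V induced_verts[OF G] by simp
  show "card (verts G) = card (D 1) + card (D 0)"
    unfolding V[symmetric] 
    by (intro card_Un_disjoint disj finite_subset[OF DV finite_verts[OF G]])
qed

text \<open>The trace of the squared adjacency matrix is the number of vertices of degree 1 by the
  degree sum, and the number of nonzero eigenvalues by the spectrum. Hence the isolated vertices are
  as many as the nullity.\<close>

lemma eigenvalues_le_1_matching:
  assumes G: "simple_graph G" and ev: "\<And>z. eigenvalue (adj_matrix G) z \<Longrightarrow> Re z \<le> 1"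
  shows "\<And>z. eigenvalue (adj_matrix G) z \<Longrightarrow> z = 0 \<or> cmod z = 1"
    and "graph_iso G (disjoint_union (copies ((card (verts G) - nullity G) div 2) (complete_graph 2))
                                     (copies (nullity G) (complete_graph 1)))"
proof -
  let ?L = "eigenvalue_list (adj_matrix G)"
  define D where "D d = {v \<in> verts G. card (neighbours G v) = d}" for d
  have deg: "card (neighbours G v) \<le> 1" for v
    by (rule card_neighbours_le_1_if_eigenvalues_le[OF G ev])
  note M = matching_graph_iso[OF G deg, folded D_def]
  have unit: "z = 0 \<or> z = 1 \<or> z = -1" if z: "eigenvalue (adj_matrix G) z" for z
  proof -
    consider "z = -1" | v where "z = of_nat (card (neighbours G v))"
      using cluster_eigenvalue[OF G M(1) z] by blast
    then show ?thesis
    proof cases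
      case 2
      have "card (neighbours G v) = 0 \<or> card (neighbours G v) = 1" using deg[of v] by linarith
      then show ?thesis using 2 by auto
    qed simp
  qed
  then show "z = 0 \<or> cmod z = 1" if "eigenvalue (adj_matrix G) z" for z using that by fastforce
  have "of_nat (\<Sum>v\<in>verts G. card (neighbours G v)) = (\<Sum>z\<leftarrow>?L. z ^ 2)"
    by (rule adj_trace2[OF G, symmetric])
  also have "\<dots> = of_nat (length (filter (\<lambda>z. z \<noteq> 0) ?L))"
    by (rule sum_list_power_unit) (simp add: set_adj_eigenvalue_list unit)
  finally have "(\<Sum>v\<in>verts G. card (neighbours G v)) = length (filter (\<lambda>z. z \<noteq> 0) ?L)"
    using of_nat_eq_iff by blast
  moreover have "(\<Sum>v\<in>verts G. card (neighbours G v)) = (\<Sum>v\<in>verts G. if card (neighbours G v) = 1 then 1 else 0)"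
    using deg by (intro sum.cong refl) (metis One_nat_def le_Suc_eq le_zero_eq)
  moreover have "\<dots> = card (D 1)"
    using finite_verts[OF G] by (simp add: D_def flip: sum.inter_filter)
  ultimately have "card (D 1) + nullity G = card (verts G)"
    using length_filter_nonzero[of ?L] by (simp add: nullity_def length_adj_eigenvalue_list)
  then have "card (D 1) = card (verts G) - nullity G" "card (D 0) = nullity G"
    using M(3) by linarith+
  then show "graph_iso G (disjoint_union (copies ((card (verts G) - nullity G) div 2) (complete_graph 2))
                                     (copies (nullity G) (complete_graph 1)))"
    using M(2) by simp
qed

lemma extremal_graph_iso:
  fixes \<rho> :: real
  assumes G: "simple_graph G" and \<rho>: "1 < \<rho>" "eigenvalue (adj_matrix G) (of_real \<rho>)"
    and rest: "\<And>z. z \<in> set (remove1 (of_real \<rho>) (eigenvalue_list (adj_matrix G))) \<Longrightarrow> z = 0 \<or> cmod z = 1"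
  shows "\<exists>l. nullity G \<le> l \<and> l + 3 \<le> card (verts G) \<and>
    graph_iso G (disjoint_union
      (disjoint_union (complete_graph (card (verts G) - l)) (copies (nullity G) (complete_graph 1)))
      (copies ((l - nullity G) div 2) (complete_graph 2)))"
proof -
  let ?L = "eigenvalue_list (adj_matrix G)"
  let ?\<rho> = "complex_of_real \<rho>"
  let ?d = "\<lambda>v. card (neighbours G v)"
  define L' where "L' = remove1 ?\<rho> ?L"
  have mem: "?\<rho> \<in> set ?L" using \<rho>(2) by (simp add: set_adj_eigenvalue_list)
  have L': "z = 0 \<or> z = 1 \<or> z = -1" if "z \<in> set L'" for z
  proof -
    have "eigenvalue (adj_matrix G) z"
      using that set_remove1_subset[of ?\<rho> ?L] by (auto simp: L'_def simp flip: set_adj_eigenvalue_list)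
    then show ?thesis using adj_eigenvalue_unit[OF G] rest that by (auto simp: L'_def)
  qed
  have ev: "z = ?\<rho> \<or> z = 0 \<or> z = 1 \<or> z = -1" if "eigenvalue (adj_matrix G) z" for z
    using that L' by (cases "z = ?\<rho>") (auto simp: L'_def simp flip: set_adj_eigenvalue_list)
  have cl: "cluster_graph G"
    by (rule cluster_graph_if_eigenvalues_ge[OF G]) (use ev \<rho>(1) in fastforce)
  \<comment> \<open>As \<open>\<rho>\<close> exceeds 1 it is not -1, so it must be a degree.\<close>
  obtain v0 where v0: "v0 \<in> verts G" "?\<rho> = of_nat (?d v0)"
    using cluster_eigenvalue[OF G cl \<rho>(2)] \<rho>(1) by (auto simp: complex_eq_iff)
  define r where "r = ?d v0"
  have \<rho>r: "\<rho> = real r" using v0(2) by (simp add: r_def complex_eq_iff)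
  have r2: "2 \<le> r" using \<rho>(1) \<rho>r by simp
  have deg: "\<forall>v\<in>verts G. ?d v \<in> {0, 1, r}"
  proof
    fix v assume "v \<in> verts G"
    from ev[OF cluster_degree_eigenvalue[OF G cl this]] show "?d v \<in> {0, 1, r}"
      using \<rho>r by (auto simp: complex_eq_iff)
  qed
  define D where "D d = {v \<in> verts G. ?d v = d}" for d
  note classes = cluster_degree_classes[OF G cl deg, folded D_def]
  have DV: "D d \<subseteq> verts G" for d by (auto simp: D_def)
  have finD: "finite (D d)" for d using DV finite_verts[OF G] by (rule finite_subset)
  have sumD: "(\<Sum>v\<in>verts G. f (?d v)) = f r * card (D r) + f 0 * card (D 0) + f 1 * card (D 1)" for f :: "nat \<Rightarrow> nat"
  proof -
    have "(\<Sum>v\<in>verts G. f (?d v)) = (\<Sum>v\<in>D r \<union> D 0 \<union> D 1. f (?d v))" using classes(1) by simp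
    also have "\<dots> = (\<Sum>v\<in>D r. f (?d v)) + (\<Sum>v\<in>D 0. f (?d v)) + (\<Sum>v\<in>D 1. f (?d v))"
      using r2 finD by (subst sum.union_disjoint, auto simp: D_def)+
    finally show ?thesis by (simp add: D_def mult.commute)
  qed
  have len: "length (filter (\<lambda>z. z \<noteq> 0) L') + nullity G + 1 = card (verts G)"
  proof -
    have "count_list L' 0 = count_list ?L 0"
      using \<rho>(1) unfolding L'_def by (induction ?L) auto
    moreover have "length L' + 1 = length ?L"
      using mem length_pos_if_in_set[OF mem] by (simp add: L'_def length_remove1)
    ultimately show ?thesis
      using length_filter_nonzero[of L'] by (simp add: nullity_def length_adj_eigenvalue_list)
  qed
  \<comment> \<open>The third trace is computed twice. Since \<open>z ^ 3 = z\<close> on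
    \<open>L'\<close> and the first trace is 0, the spectrum gives
    \<open>\<rho> ^ 3 - \<rho>\<close>; only degree \<open>r\<close> contributes triangles.\<close>
  have "of_nat (\<Sum>v\<in>verts G. \<Sum>u\<in>neighbours G v. card (neighbours G v \<inter> neighbours G u))
      = ?\<rho> ^ 3 + (\<Sum>z\<leftarrow>L'. z)"
    unfolding adj_trace3[OF G, symmetric] sum_list_remove1[OF mem, of "\<lambda>z. z ^ 3"] L'_def[symmetric]
    using sum_list_power_unit(2)[of L'] L' by simp
  moreover have "?\<rho> + (\<Sum>z\<leftarrow>L'. z) = 0"
    using adj_trace1[OF G] sum_list_remove1[OF mem, of "\<lambda>z. z"] by (simp add: L'_def)
  ultimately have "of_nat (\<Sum>v\<in>verts G. \<Sum>u\<in>neighbours G v. card (neighbours G v \<inter> neighbours G u)) + ?\<rho>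
      = ?\<rho> ^ 3" by (simp add: algebra_simps add_eq_0_iff2)
  moreover have "(\<Sum>v\<in>verts G. \<Sum>u\<in>neighbours G v. card (neighbours G v \<inter> neighbours G u))
      = r * (r - 1) * card (D r)"
  proof -
    have "(\<Sum>v\<in>verts G. \<Sum>u\<in>neighbours G v. card (neighbours G v \<inter> neighbours G u))
        = (\<Sum>v\<in>verts G. ?d v * (?d v - 1))"
      using cluster_common_neighbours[OF G cl] by (intro sum.cong refl) simp
    then show ?thesis using sumD[of "\<lambda>d. d * (d - 1)"] by simp
  qed
  ultimately have "complex_of_nat (r * (r - 1) * card (D r)) + ?\<rho> = ?\<rho> ^ 3" by (simp only:)
  then have "complex_of_nat (r * (r - 1) * card (D r) + r) = of_nat (r ^ 3)"
    by (simp only: \<rho>r of_nat_add of_nat_power of_real_of_nat_eq)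
  then have "r * (r - 1) * card (D r) + r = r ^ 3" using of_nat_eq_iff by blast
  moreover obtain q where q: "r = Suc q" "q \<noteq> 0" using r2 by (cases r) auto
  ultimately have "(r * q) * card (D r) = (r * q) * (r + 1)"
    by (simp add: power3_eq_cube algebra_simps)
  \<comment> \<open>Cancelling \<open>r * (r - 1)\<close> leaves exactly one clique of
    \<open>r + 1\<close> vertices.\<close>
  then have cardB: "card (D r) = r + 1" using q r2 by (metis mult_cancel1 mult_eq_0_iff not_numeral_le_zero)
  \<comment> \<open>The second trace, compared with the vertex count, identifies the isolated
    vertices with the nullity.\<close>
  have "of_nat (\<Sum>v\<in>verts G. ?d v) = ?\<rho> ^ 2 + of_nat (length (filter (\<lambda>z. z \<noteq> 0) L'))"
    unfolding adj_trace2[OF G, symmetric] sum_list_remove1[OF mem, of "\<lambda>z. z ^ 2"] L'_def[symmetric]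
    using sum_list_power_unit(1)[of L'] L' by simp
  then have "complex_of_nat (r * card (D r) + card (D 1)) = of_nat (r ^ 2 + length (filter (\<lambda>z. z \<noteq> 0) L'))"
    using sumD[of "\<lambda>d. d"] by (simp add: \<rho>r)
  then have tr2: "r * card (D r) + card (D 1) = r ^ 2 + length (filter (\<lambda>z. z \<noteq> 0) L')"
    using of_nat_eq_iff by blast
  have n: "card (verts G) = card (D r) + card (D 0) + card (D 1)"
    using sumD[of "\<lambda>_. 1"] by simp
  have card0: "card (D 0) = nullity G"
    using tr2 len n cardB by (simp add: power2_eq_square)
  have "v0 \<in> D r" using v0(1) by (simp add: D_def r_def)
  then have "insert v0 (neighbours G v0) \<subseteq> D r" using classes(2) by blast
  moreover have "card (insert v0 (neighbours G v0)) = card (D r)"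
    using cardB by (simp add: r_def finite_neighbours[OF G] self_notin_neighbours[OF G])
  ultimately have B: "insert v0 (neighbours G v0) = D r" using finD card_subset_eq by blast
  have clique: "adjacent G u v \<longleftrightarrow> u \<noteq> v" if "u \<in> D r" "v \<in> D r" for u v
  proof -
    have "insert u (neighbours G u) = D r"
      using cluster_closed_neighbours[OF G cl, of u v0] that(1) B by simp
    then have "v \<in> insert u (neighbours G u)" using that(2) by simp
    then show ?thesis using adjacentD(3)[OF G] by (auto simp: neighbours_iff[OF G])
  qed
  obtain t where t: "card (D 1) = t * 2" "graph_iso (induced (D 1) G) (copies t (complete_graph 2))"
    by (rule graph_iso_induced_copies[OF G cl DV classes(2), of 1 2]) (auto simp: D_def)
  obtain s where s: "card (D 0) = s * 1" "graph_iso (induced (D 0) G) (copies s (complete_graph 1))"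
    by (rule graph_iso_induced_copies[OF G cl DV classes(2), of 0 1]) (auto simp: D_def)
  have "graph_iso (induced (D r \<union> D 0) G)
      (disjoint_union (complete_graph (card (D r))) (copies s (complete_graph 1)))"
    by (rule graph_iso_induced_Un[OF graph_iso_induced_clique[OF finD clique] s(2)])
      (use r2 classes(3)[of r 0] in \<open>auto simp: D_def\<close>)
  then have "graph_iso (induced (D r \<union> D 0 \<union> D 1) G)
      (disjoint_union (disjoint_union (complete_graph (card (D r))) (copies s (complete_graph 1)))
        (copies t (complete_graph 2)))"
    by (rule graph_iso_induced_Un[OF _ t(2)])
      (use r2 classes(3)[of r 1] classes(3)[of 0 1] in \<open>auto simp: D_def\<close>)
  then have "graph_iso G
      (disjoint_union (disjoint_union (complete_graph (r + 1)) (copies (nullity G) (complete_graph 1)))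
        (copies t (complete_graph 2)))"
    using classes(1) induced_verts[OF G] s(1) card0 cardB by simp
  moreover have "card (verts G) = r + 1 + nullity G + 2 * t" using n cardB card0 t(1) by simp
  \<comment> \<open>For this witness \<open>n - l\<close> is \<open>r + 1\<close>, which is at least
    3, and \<open>l\<close> minus the nullity is twice the number of copies of the complete graph on
    two vertices.\<close>
  ultimately show ?thesis using r2 by (intro exI[of _ "nullity G + 2 * t"]) simp
qed

text \<open>Every nonzero entry counts 1, and each copy of \<open>r\<close> adds the excess
  \<open>r ^ 2 - 1\<close>. The sum thus reveals the multiplicity of \<open>r\<close>.\<close>

lemma sum_list_squares_count:
  fixes L :: "complex list"
  assumes "r \<noteq> 0" "\<And>z. z \<in> set L \<Longrightarrow> z = r \<or> z = 0 \<or> z = 1 \<or> z = -1"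
  shows "(\<Sum>z\<leftarrow>L. z ^ 2)
    = of_nat (count_list L r) * (r ^ 2 - 1) + of_nat (length (filter (\<lambda>z. z \<noteq> 0) L))"
proof -
  have "\<forall>z\<in>set L. z = r \<or> z = 0 \<or> z = 1 \<or> z = -1" using assms(2) by blast
  then show ?thesis using assms(1) by (induction L) (auto simp: algebra_simps)
qed

lemma count_list_remove1_self: "count_list (remove1 x L) x = count_list L x - 1"
  by (induction L) auto

text \<open>All eigenvalues are \<open>N - 1\<close>, 0, 1 or -1, so only the multiplicity of
  \<open>\<rho>\<close> is in question. Having as many isolated vertices as the nullity fixes the
  number of nonzero eigenvalues, and then the second trace determines that multiplicity.\<close>

lemma extremal_graph_spectrum:
  fixes \<rho> :: real
  assumes G: "simple_graph G" and \<rho>: "1 < \<rho>" "eigenvalue (adj_matrix G) (of_real \<rho>)"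
    and N: "3 \<le> N"
    and iso: "graph_iso G (disjoint_union
      (disjoint_union (complete_graph N) (copies (nullity G) (complete_graph 1)))
      (copies q (complete_graph 2)))" (is "graph_iso G ?T")
  shows "cluster_graph G"
    and "\<And>z. z \<in> set (remove1 (of_real \<rho>) (eigenvalue_list (adj_matrix G))) \<Longrightarrow> z = 0 \<or> cmod z = 1"
proof -
  let ?L = "eigenvalue_list (adj_matrix G)"
  let ?\<rho> = "complex_of_real \<rho>"
  show cl: "cluster_graph G"
    by (rule graph_iso_cluster[OF G iso])
      (intro cluster_disjoint_union cluster_copies cluster_complete_graph)
  obtain f where f: "bij_betw f (verts G) (verts ?T)"
      "\<And>v. v \<in> verts G \<Longrightarrow> card (neighbours G v) = card (neighbours ?T (f v))"
    by (rule graph_iso_card_neighbours[OF iso]) blast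
  note verts_simps = verts_disjoint_union verts_copies verts_complete_graph
  have n: "card (verts G) = N + nullity G + 2 * q"
    using bij_betw_same_card[OF f(1)] by (simp add: verts_simps card_Plus card_cartesian_product)
  have d1: "card (neighbours ?T (Inl (Inl a))) = N - 1" if "a < N" for a
    using that by (simp add: card_neighbours_disjoint_union card_neighbours_complete_graph verts_complete_graph)
  have d2: "card (neighbours ?T (Inl (Inr p))) = 0" if "p \<in> {..<nullity G} \<times> {..<1}" for p
    using that by (auto simp: card_neighbours_disjoint_union card_neighbours_copies
      card_neighbours_complete_graph verts_complete_graph)
  have d3: "card (neighbours ?T (Inr p)) = 1" if "p \<in> {..<q} \<times> {..<2}" for p
    using that by (auto simp: card_neighbours_disjoint_union card_neighbours_copies
      card_neighbours_complete_graph verts_complete_graph)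
  have degT: "card (neighbours ?T p) \<in> {0, 1, N - 1}" if p: "p \<in> verts ?T" for p
  proof -
    consider a where "p = Inl (Inl a)" "a < N" | b where "p = Inl (Inr b)" "b \<in> {..<nullity G} \<times> {..<1}"
      | c where "p = Inr c" "c \<in> {..<q} \<times> {..<2}"
      using p unfolding verts_simps by (elim PlusE) blast+
    then show ?thesis by cases (simp_all only: d1 d2 d3, simp_all)
  qed
  have "(\<Sum>v\<in>verts G. card (neighbours G v)) = (\<Sum>v\<in>verts G. card (neighbours ?T (f v)))"
    by (intro sum.cong refl f(2))
  also have "\<dots> = (\<Sum>p\<in>verts ?T. card (neighbours ?T p))"
    by (rule sum.reindex_bij_betw[OF f(1)])
  also have "\<dots> = (\<Sum>a<N. card (neighbours ?T (Inl (Inl a))))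
      + (\<Sum>p\<in>{..<nullity G} \<times> {..<1}. card (neighbours ?T (Inl (Inr p))))
      + (\<Sum>p\<in>{..<q} \<times> {..<2}. card (neighbours ?T (Inr p)))"
    unfolding verts_simps by (subst sum.Plus; simp add: o_def)+
  also have "\<dots> = (\<Sum>a<N. N - 1) + (\<Sum>p\<in>{..<nullity G} \<times> {..<1::nat}. 0) + (\<Sum>p\<in>{..<q} \<times> {..<2::nat}. 1)"
    by (intro arg_cong2[where f = "(+)"] sum.cong refl) (simp_all only: d1 d2 d3 lessThan_iff)
  also have "\<dots> = N * (N - 1) + 2 * q"
    by (simp add: card_cartesian_product)
  finally have sum_deg: "(\<Sum>v\<in>verts G. card (neighbours G v)) = N * (N - 1) + 2 * q" .
  have ev: "z = of_nat (N - 1) \<or> z = 0 \<or> z = 1 \<or> z = -1" if z: "eigenvalue (adj_matrix G) z" for z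
  proof -
    consider "z = -1" | v where "v \<in> verts G" "z = of_nat (card (neighbours G v))"
      using cluster_eigenvalue[OF G cl z] by blast
    then show ?thesis
    proof cases
      case 2
      have "f v \<in> verts ?T" using f(1) 2(1) by (auto simp: bij_betw_def)
      then have "card (neighbours G v) \<in> {0, 1, N - 1}" using degT f(2)[OF 2(1)] by simp
      then show ?thesis using 2(2) by auto
    qed simp
  qed
  have \<rho>N: "\<rho> = real (N - 1)" using ev[OF \<rho>(2)] \<rho>(1) by (auto simp: complex_eq_iff)
  define m where "m = count_list ?L ?\<rho>"
  have "complex_of_nat (N * (N - 1) + 2 * q)
      = of_nat m * (?\<rho> ^ 2 - 1) + of_nat (length (filter (\<lambda>z. z \<noteq> 0) ?L))"
    unfolding m_def sum_deg[symmetric] adj_trace2[OF G, symmetric]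
    by (rule sum_list_squares_count) (use ev \<rho>(1) \<rho>N in \<open>auto simp: set_adj_eigenvalue_list\<close>)
  moreover have "length (filter (\<lambda>z. z \<noteq> 0) ?L) = N + 2 * q"
    using length_filter_nonzero[of ?L] n by (simp add: nullity_def length_adj_eigenvalue_list)
  moreover have "real N = \<rho> + 1" using \<rho>N N by simp
  then have "complex_of_nat N = ?\<rho> + 1" by (metis of_real_1 of_real_add of_real_of_nat_eq)
  moreover have "complex_of_nat (N - 1) = ?\<rho>" by (simp add: \<rho>N)
  ultimately have "(?\<rho> + 1) * ?\<rho> + 2 * of_nat q = of_nat m * (?\<rho> ^ 2 - 1) + (?\<rho> + 1 + 2 * of_nat q)"
    by (simp only: of_nat_add of_nat_mult of_nat_numeral)
  \<comment> \<open>The two sides differ by \<open>(\<rho> + 1) * \<rho> - (\<rho> + 1)\<close>,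
    which is \<open>\<rho> ^ 2 - 1\<close>, against \<open>m\<close> times the same number.\<close>
  then have "(of_nat m - 1) * (?\<rho> ^ 2 - 1) = 0"
    by (simp add: algebra_simps power2_eq_square)
  moreover have "?\<rho> ^ 2 \<noteq> 1" using \<rho>(1) by (auto simp: power2_eq_1_iff complex_eq_iff)
  ultimately have "m = 1" by simp
  then have "?\<rho> \<notin> set (remove1 ?\<rho> ?L)"
    unfolding m_def by (simp add: count_list_remove1_self flip: count_list_0_iff)
  then show "z = 0 \<or> cmod z = 1" if "z \<in> set (remove1 (of_real \<rho>) (eigenvalue_list (adj_matrix G)))" for z
  proof -
    have "z \<in> set ?L" using that notin_set_remove1 by metis
    then have "z = ?\<rho> \<or> z = 0 \<or> z = 1 \<or> z = -1"
      using ev[of z] \<rho>N by (simp add: set_adj_eigenvalue_list)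
    moreover have "z \<noteq> ?\<rho>" using that \<open>?\<rho> \<notin> set (remove1 ?\<rho> ?L)\<close> by metis
    ultimately show ?thesis by auto
  qed
qed

text \<open>From \<open>ln t < t - 1\<close> at \<open>t = y / x\<close>, together with
  \<open>(y - x) / x \<le> y - x\<close>, which holds because \<open>x\<close> is at least
  1.\<close>

lemma diff_ln_strict_mono:
  fixes x y :: real
  assumes "1 \<le> x" "x < y"
  shows "x - ln x < y - ln y"
proof -
  have "ln (y / x) < y / x - 1"
    using ln_le_minus_one[of "y / x"] ln_eq_minus_one[of "y / x"] assms by fastforce
  also have "\<dots> = (y - x) / x" using assms by (simp add: field_simps)
  also have "\<dots> \<le> (y - x) / 1" using assms by (intro divide_left_mono) auto
  finally show ?thesis using assms by (simp add: ln_div)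
qed

lemma diff_ln_mono:
  fixes x y :: real
  assumes "1 \<le> x" "x \<le> y"
  shows "x - ln x \<le> y - ln y"
  using diff_ln_strict_mono[OF assms(1), of y] assms(2) by (cases "x = y") auto

theorem theorem11:
  fixes G G1 :: "'a ugraph"
    and n m \<kappa> n1 m1 :: nat
    and \<rho> :: real
    and \<gamma> :: "nat \<Rightarrow> real"
    and h :: "real \<Rightarrow> real"
  assumes "simple_graph G"
    and "n = card (verts G)" and "m = card (edges G)"
    and "\<rho> = largest_eigenvalue G" and "nullity G = \<kappa>"
    and "connected_component_of G1 G"
    and "spectral_radius (adj_matrix G1) = \<rho>"
    and "n1 = card (verts G1)" and "m1 = card (edges G1)"
    and "2 * real m1 / real n1 \<ge> 1"
    and "\<And>k. \<gamma> k = kdegree_ratio G1 k"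
    and "\<And>x. x > 0 \<Longrightarrow>
           h x = x + real n - real \<kappa> - 1 + ln (cmod (Upsilon (n - \<kappa>) (adj_matrix G))) - ln x"
  shows "incseq (\<lambda>k. h (\<gamma> k)) \<and>
    (\<lambda>k. h (\<gamma> k)) \<longlonglongrightarrow> h \<rho> \<and>
    (\<forall>k. energy G \<ge> \<gamma> k + real n - real \<kappa> - 1
            + ln (cmod (Upsilon (n - \<kappa>) (adj_matrix G))) - ln (\<gamma> k)) \<and>
    (\<forall>r1. regular_graph r1 G1 \<longrightarrow>
       energy G \<ge> real r1 + real n - real \<kappa> - 1
            + ln (cmod (Upsilon (n - \<kappa>) (adj_matrix G))) - ln (real r1)) \<and>
    (\<rho> = 1 \<longrightarrow>
       (\<forall>k. energy G = \<gamma> k + real n - real \<kappa> - 1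
               + ln (cmod (Upsilon (n - \<kappa>) (adj_matrix G))) - ln (\<gamma> k)
            \<longleftrightarrow> graph_iso G
                 (disjoint_union (copies ((n - \<kappa>) div 2) (complete_graph 2))
                                 (copies \<kappa> (complete_graph 1))))) \<and>
    (\<rho> > 1 \<longrightarrow>
       (\<forall>k. energy G = \<gamma> k + real n - real \<kappa> - 1
               + ln (cmod (Upsilon (n - \<kappa>) (adj_matrix G))) - ln (\<gamma> k)
            \<longleftrightarrow> (\<exists>l. \<kappa> \<le> l \<and> l + 3 \<le> n \<and>
                  graph_iso G
                    (disjoint_union
                      (disjoint_union (complete_graph (n - l)) (copies \<kappa> (complete_graph 1)))
                      (copies ((l - \<kappa>) div 2) (complete_graph 2))))))"
proof -
  note G = assms(1)
  note n = assms(2)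
  have G1: "simple_graph G1" by (rule component_simple_graph[OF assms(1,6)])
  have ne: "verts G \<noteq> {}" using assms(6) by (auto simp: connected_component_of_def)
  have \<gamma>: "\<gamma> = kdegree_ratio G1" using assms(11) by blast
  have \<gamma>0: "1 \<le> kdegree_ratio G1 0"
    using kdegree_ratio_0_ge_1[OF G1] assms(8,9,10) by simp
  have n1: "0 < card (verts G1)"
  proof (rule ccontr)
    assume "\<not> ?thesis"
    then show False using assms(8,10) by simp
  qed
  note sr = spectral_radius_mem_max[OF adj_matrix_carrier n1]
  \<comment> \<open>Only the modulus of \<open>z1\<close> is known here, and that is all the
    convergence lemma asks for.\<close>
  obtain z1 where z1: "eigenvalue (adj_matrix G1) z1" "cmod z1 = \<rho>"
    using sr(1) assms(7) by (auto simp: spectrum_def)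
  have ev1: "cmod z \<le> \<rho>" if "eigenvalue (adj_matrix G1) z" for z
    using sr(2) assms(7) that by (auto simp: spectrum_def)
  have inc: "incseq \<gamma>" unfolding \<gamma> by (rule incseq_kdegree_ratio[OF G1 \<gamma>0])
  have ge1: "1 \<le> \<gamma> k" for k using incseqD[OF inc, of 0 k] \<gamma>0 \<gamma> by simp
  have le: "\<gamma> k \<le> \<rho>" for k
    unfolding \<gamma> by (rule kdegree_ratio_le[OF G1 ev1]) (use z1(2) in auto)
  have lim: "\<gamma> \<longlonglongrightarrow> \<rho>" unfolding \<gamma> by (rule kdegree_ratio_tendsto[OF G1 \<gamma>0 ev1 z1])
  have \<rho>1: "1 \<le> \<rho>" using ge1[of 0] le[of 0] by simp
  have ev\<rho>: "eigenvalue (adj_matrix G) (of_real \<rho>)"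
    using largest_eigenvalue(1)[OF G ne] assms(4) by simp
  let ?L = "eigenvalue_list (adj_matrix G)"
  let ?rest = "\<forall>z\<in>set (remove1 (of_real \<rho>) ?L). z = 0 \<or> cmod z = 1"
  define c where "c = real n - real \<kappa> - 1 + ln (cmod (Upsilon (n - \<kappa>) (adj_matrix G)))"
  have E: "\<rho> - ln \<rho> + c \<le> energy G" "energy G = \<rho> - ln \<rho> + c \<longleftrightarrow> ?rest"
    using energy_ge[OF ev\<rho>] \<rho>1 by (simp_all add: c_def n assms(5) algebra_simps)
  have h: "h x = x - ln x + c" if "1 \<le> x" for x
    using assms(12)[of x] that by (simp add: c_def)
  have bound_eq: "\<gamma> k + real n - real \<kappa> - 1 + ln (cmod (Upsilon (n - \<kappa>) (adj_matrix G))) - ln (\<gamma> k)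
      = \<gamma> k - ln (\<gamma> k) + c" for k
    by (simp add: c_def)
  have bound: "\<gamma> k - ln (\<gamma> k) + c \<le> energy G" for k
    using diff_ln_mono[OF ge1[of k] le[of k]] E(1) by linarith
  \<comment> \<open>If \<open>\<gamma> k\<close> is below \<open>\<rho>\<close>, strict monotonicity
    separates the bound from the energy; otherwise equality is decided by the remaining
    eigenvalues.\<close>
  have equality: "energy G = \<gamma> k - ln (\<gamma> k) + c \<longleftrightarrow> \<gamma> k = \<rho> \<and> ?rest" for k
    using diff_ln_strict_mono[OF ge1[of k], of \<rho>] le[of k] E by (cases "\<gamma> k = \<rho>") auto
  have rest_eq: "eigenvalue (adj_matrix G) z" if "z \<in> set (remove1 (of_real \<rho>) ?L)" for z
    using that set_remove1_subset by (fastforce simp flip: set_adj_eigenvalue_list)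
  have "incseq (\<lambda>k. h (\<gamma> k))"
  proof (rule incseq_SucI)
    fix k
    show "h (\<gamma> k) \<le> h (\<gamma> (Suc k))"
      using diff_ln_mono[OF ge1[of k], of "\<gamma> (Suc k)"] incseq_SucD[OF inc, of k] ge1 h by simp
  qed
  moreover have "(\<lambda>k. h (\<gamma> k)) \<longlonglongrightarrow> h \<rho>"
  proof -
    have "(\<lambda>k. \<gamma> k - ln (\<gamma> k) + c) \<longlonglongrightarrow> \<rho> - ln \<rho> + c"
      using lim \<rho>1 by (intro tendsto_intros) auto
    then show ?thesis using ge1 \<rho>1 h by simp
  qed
  moreover have "energy G \<ge> real r1 + real n - real \<kappa> - 1
      + ln (cmod (Upsilon (n - \<kappa>) (adj_matrix G))) - ln (real r1)" if "regular_graph r1 G1" for r1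
    using bound[of 0] kdegree_ratio_regular[OF G1 that \<gamma>0, of 0] by (simp add: \<gamma> c_def)
  moreover have "energy G = \<gamma> k - ln (\<gamma> k) + c \<longleftrightarrow> graph_iso G
      (disjoint_union (copies ((n - \<kappa>) div 2) (complete_graph 2)) (copies \<kappa> (complete_graph 1)))"
    if \<rho>: "\<rho> = 1" for k
  proof -
    have "Re z \<le> 1" if "eigenvalue (adj_matrix G) z" for z
      using largest_eigenvalue(2)[OF G ne that] assms(4) \<rho> by simp
    note one = eigenvalues_le_1_matching[OF G this]
    \<comment> \<open>When \<open>\<rho> = 1\<close>, the ratio is squeezed between 1 and
      \<open>\<rho>\<close>. Every such graph is a matching with isolated vertices and attains
      equality, so both sides of the equivalence are true.\<close>
    have "\<gamma> k = \<rho>" using ge1[of k] le[of k] \<rho> by simp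
    moreover have ?rest using one(1) rest_eq by blast
    ultimately show ?thesis using equality[of k] one(2) n assms(5) by simp
  qed
  moreover have "energy G = \<gamma> k - ln (\<gamma> k) + c \<longleftrightarrow> (\<exists>l. \<kappa> \<le> l \<and> l + 3 \<le> n \<and> graph_iso G
      (disjoint_union (disjoint_union (complete_graph (n - l)) (copies \<kappa> (complete_graph 1)))
        (copies ((l - \<kappa>) div 2) (complete_graph 2))))" (is "_ \<longleftrightarrow> (\<exists>l. ?ext l)")
    if \<rho>: "1 < \<rho>" for k
  proof
    assume "energy G = \<gamma> k - ln (\<gamma> k) + c"
    then have "\<And>z. z \<in> set (remove1 (of_real \<rho>) ?L) \<Longrightarrow> z = 0 \<or> cmod z = 1"
      using equality by blast
    from extremal_graph_iso[OF G \<rho> ev\<rho> this] show "\<exists>l. ?ext l"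
      unfolding n assms(5) by blast
  next
    assume "\<exists>l. ?ext l"
    then obtain l where l: "l + 3 \<le> n" "?ext l" by blast
    have N: "3 \<le> n - l" using l(1) by linarith
    have "graph_iso G (disjoint_union
        (disjoint_union (complete_graph (n - l)) (copies (nullity G) (complete_graph 1)))
        (copies ((l - \<kappa>) div 2) (complete_graph 2)))"
      using l(2) assms(5) by simp
    note ext = extremal_graph_spectrum[OF G \<rho> ev\<rho> N this]
    obtain r where r: "regular_graph r G1"
      using cluster_component_regular[OF G ext(1) assms(6)] by blast
    have const: "\<gamma> = (\<lambda>_. real r)" unfolding \<gamma> using kdegree_ratio_regular[OF G1 r \<gamma>0] by blast
    \<comment> \<open>The constant sequence of ratios converges to \<open>\<rho>\<close>, so every
      one of its terms is \<open>\<rho>\<close>.\<close>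
    have "real r = \<rho>" using lim unfolding const by (simp add: LIMSEQ_const_iff)
    then have "\<gamma> k = \<rho>" by (simp add: const)
    then show "energy G = \<gamma> k - ln (\<gamma> k) + c" using equality ext(2) by blast
  qed
  ultimately show ?thesis unfolding bound_eq using bound by blast
qed

end
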